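(* Let $A\in\mathbb{P}$ and $0<t<1$, and let $f:\mathbb{P}\to\mathbb{R}_+$ be the function $$f(X)=\mathrm{tr}\left(A^{\frac{1-t}{2t}}XA^{\frac{1-t}{2t}}\right)^{t}.$$ Let $\mathbb{K}$ be a compact convex subset of $\mathbb{P}$. Let $\alpha,\beta$ be positive numbers such that $\alpha I\le Y\le \beta I$ for all $Y\in\mathbb{K}\cup\{A\}$. Then for all $X\in\mathbb{K}$ $$t(1-t)\,\alpha^{1-t}\beta^{t-2}\;\le\;-\nabla^2 f(X)\;\le\; t(1-t)\,\beta^{1-t}\alpha^{t-2}.$$
   Context: $\mathbb{P}$ is the set of $n\times n$ complex positive definite matrices, an open subset of the real vector space $\mathbb{H}$ of $n\times n$ complex Hermitian matrices, which carries the inner product $\langle X,Y\rangle=\mathrm{tr}(XY)$. $\mathbb{R}_+=[0,\infty)$. For Hermitian matrices, $X\le Y$ means $Y-X$ is positive semidefinite. $\mathrm{tr}(Z)^t$ means the trace of $Z^t$. For a smooth $f:\mathbb{P}\to\mathbb{R}$, the Hessian $\nabla^2 f(X)$ is the self-adjoint linear operator on $\mathbb{H}$ determined by $\langle\nabla^2 f(X)(Y),Z\rangle=D^2f(X)(Y,Z)$, where $D^2f(X)$ is the second Fréchet derivative. For real $k$, $k\le T$ (resp. $T\le k$) for a self-adjoint operator $T$ on $\mathbb{H}$ means $k\langle Y,Y\rangle\le\langle T(Y),Y\rangle$ (resp. $\langle T(Y),Y\rangle\le k\langle Y,Y\rangle$) for all $Y\in\mathbb{H}$. *)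

theory Defs
  imports "HOL-Analysis.Analysis"
begin

definition adjoint_mat :: "complex^'n^'n \<Rightarrow> complex^'n^'n" where
  "adjoint_mat A = (\<chi> i j. cnj (A $ j $ i))"

definition hermitian :: "complex^'n^'n \<Rightarrow> bool" where
  "hermitian A \<longleftrightarrow> adjoint_mat A = A"

(* The inner product of the real inner product space complex^'n is the real part of the
   complex one, and x* A x is real when A is Hermitian. *)
definition pos_semidef :: "complex^'n^'n \<Rightarrow> bool" where
  "pos_semidef A \<longleftrightarrow> hermitian A \<and> (\<forall>x. 0 \<le> x \<bullet> (A *v x))"

definition pos_def :: "complex^'n^'n \<Rightarrow> bool" where
  "pos_def A \<longleftrightarrow> hermitian A \<and> (\<forall>x. x \<noteq> 0 \<longrightarrow> 0 < x \<bullet> (A *v x))"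

definition loewner_le :: "complex^'n^'n \<Rightarrow> complex^'n^'n \<Rightarrow> bool" where
  "loewner_le A B \<longleftrightarrow> pos_semidef (B - A)"

definition unitary :: "complex^'n^'n \<Rightarrow> bool" where
  "unitary U \<longleftrightarrow> adjoint_mat U ** U = mat 1"

definition real_diag :: "('n \<Rightarrow> real) \<Rightarrow> complex^'n^'n" where
  "real_diag d = (\<chi> i j. if i = j then complex_of_real (d i) else 0)"

(* Functional calculus of a Hermitian matrix.  The matrix B does not depend on the
   choice of the diagonalisation. *)
definition mat_fun :: "(real \<Rightarrow> real) \<Rightarrow> complex^'n^'n \<Rightarrow> complex^'n^'n" where
  "mat_fun g A = (THE B. \<exists>U d. unitary U \<and>
      A = U ** real_diag d ** adjoint_mat U \<and>
      B = U ** real_diag (\<lambda>i. g (d i)) ** adjoint_mat U)"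

definition mat_powr :: "complex^'n^'n \<Rightarrow> real \<Rightarrow> complex^'n^'n" where
  "mat_powr A s = mat_fun (\<lambda>x. x powr s) A"

(* The Hermitian matrices form a type of their own, so that derivatives of functions on
   them are taken inside this real vector space and not inside complex^'n^'n. *)
typedef ('n::finite) herm = "{A :: complex^'n^'n. hermitian A}"
  morphisms mat_of Herm
proof
  show "0 \<in> {A :: complex^'n^'n. hermitian A}"
    by (simp add: hermitian_def adjoint_mat_def vec_eq_iff)
qed

setup_lifting type_definition_herm

lemma trace_mult_hermitian:
  assumes "hermitian B"
  shows "Re (trace (A ** B)) = A \<bullet> B"
proof -
  have B: "cnj (B $ i $ k) = B $ k $ i" for i k
  proof -
    have "adjoint_mat B $ k $ i = B $ k $ i"
      using assms by (simp only: hermitian_def)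
    then show ?thesis
      by (simp add: adjoint_mat_def)
  qed
  have "Re (z * cnj w) = z \<bullet> w" for z w :: complex
    by (simp add: inner_complex_def)
  then have entry: "Re (A $ i $ k * B $ k $ i) = A $ i $ k \<bullet> B $ i $ k" for i k
    using B[of i k] by metis
  show ?thesis
    by (simp only: trace_def matrix_matrix_mult_def inner_vec_def vec_lambda_beta Re_sum entry)
qed

instantiation herm :: (finite) real_inner
begin

lift_definition zero_herm :: "'a herm" is 0
  by (simp add: hermitian_def adjoint_mat_def vec_eq_iff)

lift_definition plus_herm :: "'a herm \<Rightarrow> 'a herm \<Rightarrow> 'a herm" is "(+)"
  by (simp add: hermitian_def adjoint_mat_def vec_eq_iff)

lift_definition minus_herm :: "'a herm \<Rightarrow> 'a herm \<Rightarrow> 'a herm" is "(-)"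
  by (simp add: hermitian_def adjoint_mat_def vec_eq_iff)

lift_definition uminus_herm :: "'a herm \<Rightarrow> 'a herm" is uminus
  by (simp add: hermitian_def adjoint_mat_def vec_eq_iff)

lift_definition scaleR_herm :: "real \<Rightarrow> 'a herm \<Rightarrow> 'a herm" is "(*\<^sub>R)"
  by (simp add: hermitian_def adjoint_mat_def vec_eq_iff)

(* The trace of a product of two Hermitian matrices is real. *)
definition inner_herm :: "'a herm \<Rightarrow> 'a herm \<Rightarrow> real" where
  "inner_herm X Y = Re (trace (mat_of X ** mat_of Y))"

definition norm_herm :: "'a herm \<Rightarrow> real" where
  "norm_herm X = sqrt (inner X X)"

definition sgn_herm :: "'a herm \<Rightarrow> 'a herm" where
  "sgn_herm X = inverse (norm X) *\<^sub>R X"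

definition dist_herm :: "'a herm \<Rightarrow> 'a herm \<Rightarrow> real" where
  "dist_herm X Y = norm (X - Y)"

definition uniformity_herm :: "('a herm \<times> 'a herm) filter" where
  "uniformity_herm = (INF e\<in>{0<..}. principal {(x, y). dist x y < e})"

definition open_herm :: "'a herm set \<Rightarrow> bool" where
  "open_herm U \<longleftrightarrow> (\<forall>x\<in>U. \<forall>\<^sub>F (x', y) in uniformity. x' = x \<longrightarrow> y \<in> U)"

instance
proof
  have inner_eq: "inner X Y = mat_of X \<bullet> mat_of Y" for X Y :: "'a herm"
    using mat_of[of Y] by (simp add: inner_herm_def trace_mult_hermitian)
  fix X Y Z :: "'a herm" and a b :: real
  show "X + Y + Z = X + (Y + Z)" by transfer simp
  show "X + Y = Y + X" by transfer simp
  show "0 + X = X" by transfer simp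
  show "- X + X = 0" by transfer simp
  show "X - Y = X + - Y" by transfer simp
  show "a *\<^sub>R (X + Y) = a *\<^sub>R X + a *\<^sub>R Y" by transfer (simp add: scaleR_right_distrib)
  show "(a + b) *\<^sub>R X = a *\<^sub>R X + b *\<^sub>R X" by transfer (simp add: scaleR_left_distrib)
  show "a *\<^sub>R b *\<^sub>R X = (a * b) *\<^sub>R X" by transfer simp
  show "1 *\<^sub>R X = X" by transfer simp
  show "dist X Y = norm (X - Y)" by (fact dist_herm_def)
  show "sgn X = inverse (norm X) *\<^sub>R X" by (fact sgn_herm_def)
  show "uniformity = (INF e\<in>{0<..}. principal {(x :: 'a herm, y). dist x y < e})"
    by (fact uniformity_herm_def)
  show "open U \<longleftrightarrow> (\<forall>x\<in>U. \<forall>\<^sub>F (x', y) in uniformity. x' = x \<longrightarrow> y \<in> U)"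
    for U :: "'a herm set"
    by (fact open_herm_def)
  show "inner X Y = inner Y X" by (simp add: inner_eq inner_commute)
  show "inner (X + Y) Z = inner X Z + inner Y Z"
    by (simp add: inner_eq plus_herm.rep_eq inner_add_left)
  show "inner (a *\<^sub>R X) Y = a * inner X Y"
    by (simp add: inner_eq scaleR_herm.rep_eq)
  show "0 \<le> inner X X" by (simp add: inner_eq)
  show "inner X X = 0 \<longleftrightarrow> X = 0"
    by (simp add: inner_eq mat_of_inject[symmetric] zero_herm.rep_eq)
  show "norm X = sqrt (inner X X)" by (fact norm_herm_def)
qed

end

definition posdef_herm :: "('n::finite) herm set" where
  "posdef_herm = {X. pos_def (mat_of X)}"

definition first_deriv :: "('a::real_normed_vector \<Rightarrow> real) \<Rightarrow> 'a \<Rightarrow> 'a \<Rightarrow>\<^sub>L real" where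
  "first_deriv f X = Blinfun (frechet_derivative f (at X))"

definition second_deriv :: "('a::real_normed_vector \<Rightarrow> real) \<Rightarrow> 'a \<Rightarrow> 'a \<Rightarrow> 'a \<Rightarrow> real" where
  "second_deriv f X Y Z = blinfun_apply (frechet_derivative (first_deriv f) (at X) Y) Z"

(* The equation determines the operator; it is self-adjoint by symmetry of the second
   derivative when f is twice differentiable near X. *)
definition hessian :: "('a::real_inner \<Rightarrow> real) \<Rightarrow> 'a \<Rightarrow> 'a \<Rightarrow> 'a" where
  "hessian f X = (THE T. \<forall>Y Z. inner (T Y) Z = second_deriv f X Y Z)"

definition scalar_le_op :: "real \<Rightarrow> ('a::real_inner \<Rightarrow> 'a) \<Rightarrow> bool" where
  "scalar_le_op k T \<longleftrightarrow> (\<forall>Y. k * inner Y Y \<le> inner (T Y) Y)"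

definition op_le_scalar :: "('a::real_inner \<Rightarrow> 'a) \<Rightarrow> real \<Rightarrow> bool" where
  "op_le_scalar T k \<longleftrightarrow> (\<forall>Y. inner (T Y) Y \<le> k * inner Y Y)"

end

theory Submission
  imports Defs
begin

text \<open>
  Write \<open>C = A\<^bsup>(1-t)/2t\<^esup>\<close>, so that \<open>f X = tr (C X C)\<^bsup>t\<^esup>\<close>. Formally, the gradient of \<open>f\<close> at \<open>X\<close> is
  \<open>G X = t C (C X C)\<^bsup>t-1\<^esup> C\<close>. The formula \<open>x\<^bsup>t-1\<^esup> = c \<integral> s\<^bsup>t-1\<^esup> / (x + s) ds\<close> over the
  positive half-line and \<open>C (C X C + s)\<^sup>-\<^sup>1 C = (X + s B)\<^sup>-\<^sup>1\<close> with \<open>B = C\<^sup>-\<^sup>2\<close> turn it into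
  \<open>G X = t c \<integral> s\<^bsup>t-1\<^esup> (X + s B)\<^sup>-\<^sup>1 ds\<close>. Differentiating under the integral,
  \<open>- \<langle>\<nabla>\<^sup>2 f(X) Y, Y\<rangle> = t c \<integral> s\<^bsup>t-1\<^esup> tr (R\<^sub>s Y R\<^sub>s Y) ds\<close> with \<open>R\<^sub>s = (X + s B)\<^sup>-\<^sup>1\<close>.
  Here \<open>X\<close> and \<open>B\<close> enter additively, so scalar bounds for \<open>A\<close> and \<open>X\<close> give scalar bounds for
  \<open>X + s B\<close>. In an eigenbasis of \<open>X + s B\<close> these bound \<open>tr (R\<^sub>s Y R\<^sub>s Y)\<close> by multiples of \<open>tr Y\<^sup>2\<close>
  (\<open>inner_sandwich_matrix_inv\<close>). What remains is the scalar integral for \<open>A = a I\<close> and \<open>X = x I\<close>, where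
  the second derivative of \<open>a\<^bsup>1-t\<^esup> x\<^bsup>t\<^esup>\<close> is explicit; the two extreme choices of \<open>a\<close> and \<open>x\<close> are the two
  bounds (\<open>pencil_integral_deriv_bounds\<close>).

  That \<open>G\<close> is the gradient of \<open>f\<close> needs no differentiation of eigenvalues: Klein's inequality
  (\<open>trace_powr_le_tangent\<close>) says that \<open>f\<close> lies below the affine function defined by \<open>G\<close> at each
  point, and a continuous field of supergradients is a gradient (\<open>has_derivative_supergradient\<close>). That
  \<open>G\<close> is differentiable follows from the resolvent expansion \<open>R' = R - R H R + R' H R H R\<close>, whose
  remainder is integrable and quadratic in \<open>H\<close> (\<open>pencil_integral_remainder\<close>).

  Underneath lies the spectral theorem, proved by maximising Rayleigh quotients
  (\<open>spectral_theorem\<close>); it also shows that the functional calculus does not depend on the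
  diagonalisation (\<open>mat_fun_spec_mat\<close>).
\<close>

section \<open>Adjoints, inner products and unitary matrices\<close>

lemma adjoint_mat_nth [simp]: "adjoint_mat A $ i $ j = cnj (A $ j $ i)"
  by (simp add: adjoint_mat_def)

lemma adjoint_mat_adjoint_mat [simp]: "adjoint_mat (adjoint_mat A) = A"
  by (simp add: vec_eq_iff)

lemma adjoint_mat_mult: "adjoint_mat (A ** B) = adjoint_mat B ** adjoint_mat A"
  by (simp add: vec_eq_iff matrix_matrix_mult_def mult.commute)

lemma adjoint_mat_1 [simp]: "adjoint_mat (mat 1) = mat 1"
  by (simp add: vec_eq_iff mat_def)

lemma bounded_linear_adjoint: "bounded_linear (adjoint_mat :: complex^'n^'n \<Rightarrow> complex^'n^'n)"
  unfolding linear_conv_bounded_linear[symmetric] by (auto intro!: linearI simp: vec_eq_iff)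

lemma adjoint_mat_scaleR: "adjoint_mat (c *\<^sub>R A) = c *\<^sub>R adjoint_mat A"
  and adjoint_mat_minus: "adjoint_mat (- A) = - adjoint_mat A"
  by (simp_all add: vec_eq_iff)

lemma matrix_vector_mult_scaleR_complex: "A *v (s *\<^sub>R x) = s *\<^sub>R (A *v x)"
  for A :: "complex^'n^'m"
  by (simp add: vec_eq_iff matrix_vector_mult_def scaleR_right.sum)

lemma bounded_bilinear_matrix_mult:
  "bounded_bilinear (\<lambda>(A::complex^'n^'n) (B::complex^'n^'n). A ** B)"
  unfolding bilinear_conv_bounded_bilinear[symmetric] bilinear_def
  by (auto intro!: linearI
      simp: vec_eq_iff matrix_matrix_mult_def algebra_simps sum.distrib scaleR_right.sum)

interpretation matmul: bounded_bilinear "\<lambda>(A::complex^'n^'n) (B::complex^'n^'n). A ** B"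
  by (rule bounded_bilinear_matrix_mult)

lemma inner_mat_eq_trace: "A \<bullet> B = Re (trace (A ** adjoint_mat B))"
  for A B :: "complex^'n^'n"
  by (simp add: inner_vec_def trace_def matrix_matrix_mult_def inner_complex_def)

lemma inner_mat_1: "Re (trace A) = A \<bullet> mat 1"
  by (simp add: inner_mat_eq_trace)

lemma inner_matrix_mult_left: "(A ** B) \<bullet> C = B \<bullet> (adjoint_mat A ** C)"
  for A B C :: "complex^'n^'n"
  using trace_mul_sym[of A "B ** adjoint_mat C"]
  by (simp add: inner_mat_eq_trace adjoint_mat_mult matrix_mul_assoc)

lemma inner_matrix_mult_right: "(A ** B) \<bullet> C = A \<bullet> (C ** adjoint_mat B)"
  for A B C :: "complex^'n^'n"
  unfolding inner_mat_eq_trace adjoint_mat_mult by (simp add: matrix_mul_assoc)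

lemma inner_matrix_vector: "x \<bullet> (A *v y) = (adjoint_mat A *v x) \<bullet> y"
  for A :: "complex^'n^'n"
proof -
  have c: "z \<bullet> (a * w) = (cnj a * z) \<bullet> w" for z a w :: complex
    by (simp add: inner_complex_def algebra_simps)
  have "x \<bullet> (A *v y) = (\<Sum>i\<in>UNIV. \<Sum>j\<in>UNIV. x $ i \<bullet> (A $ i $ j * y $ j))"
    by (simp add: inner_vec_def matrix_vector_mult_def inner_sum_right)
  also have "\<dots> = (\<Sum>j\<in>UNIV. \<Sum>i\<in>UNIV. x $ i \<bullet> (A $ i $ j * y $ j))"
    by (rule sum.swap)
  also have "\<dots> = (adjoint_mat A *v x) \<bullet> y"
    by (simp add: inner_vec_def matrix_vector_mult_def inner_sum_left c)
  finally show ?thesis .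
qed

lemma hermitian_congruence: "hermitian C \<Longrightarrow> hermitian M \<Longrightarrow> hermitian (C ** M ** C)"
  by (simp add: hermitian_def adjoint_mat_mult matrix_mul_assoc)

lemma unitaryD:
  assumes "unitary U"
  shows "adjoint_mat U ** U = mat 1" "U ** adjoint_mat U = mat 1"
  using assms matrix_left_right_inverse unfolding unitary_def by blast+

section \<open>The spectral theorem\<close>

text \<open>The ambient inner product on complex vectors is the real part of the complex one. The imaginary
  part is recovered by multiplying one argument by \<open>\<i>\<close>, which makes complex orthogonality two real
  orthogonality conditions.\<close>

definition cinner :: "complex^'n \<Rightarrow> complex^'n \<Rightarrow> complex" where
  "cinner x y = (\<Sum>k\<in>UNIV. cnj (x $ k) * y $ k)"

definition mul_i :: "complex^'n \<Rightarrow> complex^'n" where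
  "mul_i x = (\<chi> k. \<i> * x $ k)"

lemma cinner_eq_inner: "cinner x y = Complex (x \<bullet> y) (mul_i x \<bullet> y)"
  by (simp add: complex_eq_iff cinner_def mul_i_def inner_vec_def inner_complex_def algebra_simps)

lemma cinner_eq_0_iff: "cinner x y = 0 \<longleftrightarrow> x \<bullet> y = 0 \<and> mul_i x \<bullet> y = 0"
  by (simp add: cinner_eq_inner complex_eq_iff)

lemma cinner_self: "cinner x x = of_real (x \<bullet> x)"
  by (simp add: complex_eq_iff cinner_def inner_vec_def inner_complex_def algebra_simps)

lemma cinner_commute: "cinner y x = cnj (cinner x y)"
  by (simp add: cinner_def mult.commute)

lemma cinner_matrix: "cinner x (A *v y) = cinner (adjoint_mat A *v x) y"
  for A :: "complex^'n^'n"
proof -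
  have "cinner x (A *v y) = (\<Sum>i\<in>UNIV. \<Sum>j\<in>UNIV. cnj (x $ i) * (A $ i $ j * y $ j))"
    by (simp add: cinner_def matrix_vector_mult_def sum_distrib_left)
  also have "\<dots> = (\<Sum>j\<in>UNIV. \<Sum>i\<in>UNIV. cnj (x $ i) * (A $ i $ j * y $ j))"
    by (rule sum.swap)
  also have "\<dots> = cinner (adjoint_mat A *v x) y"
    by (simp add: cinner_def matrix_vector_mult_def sum_distrib_right sum_distrib_left mult_ac)
  finally show ?thesis .
qed

text \<open>A maximiser of the Rayleigh quotient on an invariant real subspace is an eigenvector: the
  first variation in the direction of the residual, which stays in the subspace, must vanish.\<close>

lemma rayleigh_maximiser_eigenvector:
  fixes A :: "complex^'n^'n"
  assumes A: "hermitian A" and S: "subspace S" "\<And>x. x \<in> S \<Longrightarrow> A *v x \<in> S"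
    and v: "v \<in> S" "v \<bullet> v = 1"
    and max: "\<And>w. w \<in> S \<Longrightarrow> w \<bullet> (A *v w) \<le> \<mu> * (w \<bullet> w)" and \<mu>: "\<mu> = v \<bullet> (A *v v)"
  shows "A *v v = \<mu> *\<^sub>R v"
proof -
  define z where "z = A *v v - \<mu> *\<^sub>R v"
  define q where "q = z \<bullet> z"
  define p where "p = z \<bullet> (A *v z) - \<mu> * q"
  have zS: "z \<in> S"
    unfolding z_def by (intro subspace_diff subspace_scale S v)
  have sym: "x \<bullet> (A *v y) = y \<bullet> (A *v x)" for x y
    using A by (simp add: inner_matrix_vector[of x A y] hermitian_def inner_commute)
  have Av: "A *v v = z + \<mu> *\<^sub>R v" by (simp add: z_def)
  have var: "2 * s * q + s * s * p \<le> 0" for s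
  proof -
    have "v + s *\<^sub>R z \<in> S" by (intro subspace_add subspace_scale S v zS)
    from max[OF this]
    have "v \<bullet> (A *v v) + 2 * s * (z \<bullet> (A *v v)) + s * s * (z \<bullet> (A *v z))
        \<le> \<mu> * (v \<bullet> v + 2 * s * (z \<bullet> v) + s * s * (z \<bullet> z))"
      using sym[of v z]
      by (simp add: matrix_vector_right_distrib matrix_vector_mult_scaleR_complex inner_add_left
          inner_add_right inner_commute[of v z] algebra_simps)
    then show ?thesis
      unfolding p_def using v(2) \<mu>[symmetric]
      by (simp add: Av inner_add_right q_def[symmetric] algebra_simps)
  qed
  have "q \<le> 0"
  proof (rule ccontr)
    assume "\<not> q \<le> 0"
    then have q: "q > 0" by simp
    define s where "s = q / (\<bar>p\<bar> + 1)"
    have s: "s > 0" using q by (simp add: s_def)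
    have "s * (2 * q + s * p) \<le> 0" using var[of s] by (simp add: algebra_simps)
    then have "2 * q + s * p \<le> 0" using s by (simp add: mult_le_0_iff)
    moreover have "\<bar>s * p\<bar> \<le> q"
      using q by (simp add: s_def abs_mult field_simps)
    ultimately show False using q by linarith
  qed
  then have "z = 0" unfolding q_def by (metis inner_eq_zero_iff inner_ge_zero antisym)
  then show ?thesis by (simp add: z_def)
qed

text \<open>Orthonormal eigenvectors are found one at a time. Fewer than \<open>CARD('n)\<close> of them span, together
  with their multiples by \<open>\<i>\<close>, a proper real subspace of the \<open>2 CARD('n)\<close>-dimensional real
  space, so the orthogonal complement still contains a maximiser of the Rayleigh quotient.\<close>

lemma orthonormal_eigenvectors:
  fixes A :: "complex^'n^'n"
  assumes A: "hermitian A"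
  shows "k \<le> CARD('n) \<Longrightarrow> \<exists>v d. (\<forall>i<k. A *v v i = d i *\<^sub>R v i) \<and>
           (\<forall>i<k. \<forall>j<k. cinner (v i) (v j) = (if i = j then 1 else 0))"
proof (induction k)
  case 0
  then show ?case by simp
next
  case (Suc k)
  then obtain v :: "nat \<Rightarrow> complex^'n" and d where
    ev: "\<And>i. i < k \<Longrightarrow> A *v v i = d i *\<^sub>R v i"
    and on: "\<And>i j. i < k \<Longrightarrow> j < k \<Longrightarrow> cinner (v i) (v j) = (if i = j then 1 else 0)"
    by auto
  define S where "S = {w. \<forall>i<k. cinner (v i) w = 0}"
  have S_eq: "S = {w. \<forall>i<k. v i \<bullet> w = 0 \<and> mul_i (v i) \<bullet> w = 0}"
    by (simp add: S_def cinner_eq_0_iff)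
  have S_sub: "subspace S"
    unfolding S_eq subspace_def by (simp add: inner_add_right)
  have S_inv: "A *v x \<in> S" if "x \<in> S" for x
  proof -
    have "cinner (v i) (A *v x) = d i *\<^sub>R cinner (v i) x" if "i < k" for i
      using A ev[OF that] unfolding cinner_matrix[of _ A] hermitian_def
      by (simp add: cinner_def scaleR_right.sum)
    then show ?thesis using that by (simp add: S_def)
  qed
  define T where "T = v ` {..<k} \<union> (\<lambda>i. mul_i (v i)) ` {..<k}"
  have "dim (span T) \<le> card T" by (simp add: T_def dim_le_card' dim_span)
  also have "\<dots> \<le> k + k"
    unfolding T_def by (intro order_trans[OF card_Un_le] add_mono card_image_le[THEN order_trans]) auto
  also have "\<dots> < DIM(complex^'n)" using Suc.prems by simp
  finally obtain x where x: "x \<noteq> 0" "\<And>y. y \<in> span T \<Longrightarrow> orthogonal x y"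
    using orthogonal_to_subspace_exists[of T] by (auto simp: dim_span)
  have xS: "x \<in> S"
  proof -
    have "y \<bullet> x = 0" if "y \<in> T" for y
      using x(2)[OF span_base[OF that]] by (simp add: orthogonal_def inner_commute)
    then show ?thesis unfolding S_eq T_def by auto
  qed
  have "closed S" by (simp add: S_sub closed_subspace)
  then have "compact (S \<inter> sphere 0 1)" by (intro closed_Int_compact) auto
  moreover have "x /\<^sub>R norm x \<in> S \<inter> sphere 0 1"
    using x(1) xS S_sub by (simp add: subspace_scale)
  moreover have "continuous_on (S \<inter> sphere 0 1) (\<lambda>x. x \<bullet> (A *v x))"
    by (intro continuous_intros linear_continuous_on_compose matrix_vector_mul_bounded_linear
        bounded_linear.continuous_on[OF matrix_vector_mul_bounded_linear])
  ultimately obtain w where w: "w \<in> S" "norm w = 1"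
    and wmax: "\<And>y. y \<in> S \<Longrightarrow> norm y = 1 \<Longrightarrow> y \<bullet> (A *v y) \<le> w \<bullet> (A *v w)"
    using continuous_attains_sup[of "S \<inter> sphere 0 1" "\<lambda>x. x \<bullet> (A *v x)"] by force
  define \<mu> where "\<mu> = w \<bullet> (A *v w)"
  have "A *v w = \<mu> *\<^sub>R w"
  proof (rule rayleigh_maximiser_eigenvector[OF A S_sub S_inv w(1) _ _ \<mu>_def])
    show "w \<bullet> w = 1" using w(2) by (simp add: norm_eq_1)
    fix y assume y: "y \<in> S"
    show "y \<bullet> (A *v y) \<le> \<mu> * (y \<bullet> y)"
    proof (cases "y = 0")
      case False
      then have "(y /\<^sub>R norm y) \<bullet> (A *v (y /\<^sub>R norm y)) \<le> \<mu>"
        unfolding \<mu>_def by (intro wmax subspace_scale S_sub y) simp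
      then show ?thesis using False
        by (simp add: matrix_vector_mult_scaleR_complex field_simps power2_norm_eq_inner[symmetric]
            power2_eq_square)
    qed simp
  qed
  moreover have "cinner w w = 1" using w(2) by (simp add: cinner_self norm_eq_1)
  moreover have "cinner (v i) w = 0" "cinner w (v i) = 0" if "i < k" for i
    using w(1) that cinner_commute[of w "v i"] by (auto simp: S_def)
  ultimately show ?case using ev on
    by (intro exI[of _ "v(k := w)"] exI[of _ "d(k := \<mu>)"]) (auto simp: less_Suc_eq)
qed

theorem spectral_theorem:
  fixes A :: "complex^'n^'n"
  assumes "hermitian A"
  obtains U d where "unitary U" "A = U ** real_diag d ** adjoint_mat U"
proof -
  obtain v :: "nat \<Rightarrow> complex^'n" and d where
    ev: "\<And>i. i < CARD('n) \<Longrightarrow> A *v v i = d i *\<^sub>R v i"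
    and on: "\<And>i j. i < CARD('n) \<Longrightarrow> j < CARD('n) \<Longrightarrow>
               cinner (v i) (v j) = (if i = j then 1 else 0)"
    using orthonormal_eigenvectors[OF assms, of "CARD('n)"] by auto
  obtain e :: "'n \<Rightarrow> nat" where e: "bij_betw e UNIV {0..<CARD('n)}"
    using ex_bij_betw_finite_nat[of "UNIV :: 'n set"] by auto
  then have el: "e i < CARD('n)" and ei: "e i = e j \<longleftrightarrow> i = j" for i j
    by (auto simp: bij_betw_def inj_on_def)
  define U :: "complex^'n^'n" where "U = (\<chi> i j. v (e j) $ i)"
  have "(adjoint_mat U ** U) $ i $ j = mat 1 $ i $ j" for i j
    using on[OF el[of i] el[of j]]
    by (simp add: U_def matrix_matrix_mult_def cinner_def mat_def ei)
  then have U: "unitary U" by (simp add: unitary_def vec_eq_iff)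
  have "(A ** U) $ i $ j = (U ** real_diag (\<lambda>i. d (e i))) $ i $ j" for i j
    using arg_cong[OF ev[OF el[of j]], of "\<lambda>x. x $ i"]
    by (simp add: U_def matrix_matrix_mult_def matrix_vector_mult_def real_diag_def
        if_distrib[of "\<lambda>x. _ * x"] scaleR_conv_of_real[where 'a = complex] mult.commute cong: if_cong)
  then have "A ** U = U ** real_diag (\<lambda>i. d (e i))" by (simp add: vec_eq_iff)
  then have "A ** (U ** adjoint_mat U) = U ** real_diag (\<lambda>i. d (e i)) ** adjoint_mat U"
    by (simp add: matrix_mul_assoc)
  then show ?thesis using that U by (simp add: unitaryD(2)[OF U])
qed

section \<open>Matrices in spectral form\<close>

definition spec_mat :: "complex^'n^'n \<Rightarrow> ('n \<Rightarrow> real) \<Rightarrow> complex^'n^'n" where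
  "spec_mat U d = U ** real_diag d ** adjoint_mat U"

lemma real_diag_nth [simp]: "real_diag d $ i $ j = (if i = j then of_real (d i) else 0)"
  by (simp add: real_diag_def)

lemma real_diag_mult_left_nth: "(real_diag d ** A) $ i $ j = d i *\<^sub>R A $ i $ j"
  by (simp add: matrix_matrix_mult_def if_distrib[of "\<lambda>x. x * _"] scaleR_conv_of_real[where 'a = complex] cong: if_cong)

lemma real_diag_mult_right_nth: "(A ** real_diag d) $ i $ j = d j *\<^sub>R A $ i $ j"
  by (simp add: matrix_matrix_mult_def if_distrib[of "\<lambda>x. _ * x"] scaleR_conv_of_real[where 'a = complex]
      mult.commute cong: if_cong)

lemma real_diag_mult: "real_diag d ** real_diag e = real_diag (\<lambda>i. d i * e i)"
  by (simp add: vec_eq_iff real_diag_mult_left_nth scaleR_conv_of_real[where 'a = complex])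

lemma adjoint_real_diag [simp]: "adjoint_mat (real_diag d) = real_diag d"
  by (simp add: vec_eq_iff)

lemma hermitian_spec_mat: "hermitian (spec_mat U d)"
  by (simp add: hermitian_def spec_mat_def adjoint_mat_mult matrix_mul_assoc)

lemma hermitian_imp_spec_mat:
  assumes "hermitian A" obtains U d where "unitary U" "A = spec_mat U d"
  using spectral_theorem[OF assms] unfolding spec_mat_def by metis

lemma unitary_cancel:
  assumes "unitary U"
  shows "adjoint_mat U ** (U ** A) = A" "U ** (adjoint_mat U ** A) = A"
  by (simp_all add: matrix_mul_assoc unitaryD[OF assms])

lemma spec_mat_mult:
  assumes "unitary U"
  shows "spec_mat U d ** spec_mat U e = spec_mat U (\<lambda>i. d i * e i)"
  by (simp add: spec_mat_def matrix_mul_assoc[symmetric] unitary_cancel[OF assms]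
      real_diag_mult[symmetric])

lemma spec_mat_const:
  fixes U :: "complex^'n^'n"
  assumes "unitary U"
  shows "spec_mat U (\<lambda>_. c) = c *\<^sub>R mat 1"
proof -
  have "real_diag (\<lambda>_::'n. c) = c *\<^sub>R mat 1"
    by (simp add: vec_eq_iff mat_def scaleR_conv_of_real[where 'a = complex])
  then show ?thesis
    by (simp add: spec_mat_def matmul.scaleR_left matmul.scaleR_right unitaryD[OF assms])
qed

lemma spec_mat_add: "spec_mat U (\<lambda>i. d i + e i) = spec_mat U d + spec_mat U e"
proof -
  have "real_diag (\<lambda>i. d i + e i) = real_diag d + real_diag e"
    by (simp add: vec_eq_iff)
  then show ?thesis by (simp add: spec_mat_def matmul.add_left matmul.add_right)
qed

lemma spec_mat_eq_sum:
  "spec_mat U d = (\<Sum>k\<in>UNIV. d k *\<^sub>R spec_mat U (\<lambda>i. if i = k then 1 else 0))"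
proof -
  have d: "real_diag d = (\<Sum>k\<in>UNIV. d k *\<^sub>R real_diag (\<lambda>i. if i = k then 1 else 0))"
    by (simp add: vec_eq_iff scaleR_conv_of_real[where 'a = complex] if_distrib[of "\<lambda>x. _ * x"]
        if_distrib[of of_real] sum.delta' cong: if_cong)
  show ?thesis
    unfolding spec_mat_def
    by (subst d) (simp add: matmul.sum_left matmul.sum_right matmul.scaleR_left matmul.scaleR_right)
qed

lemma inner_unitary_conj:
  assumes "unitary U"
  shows "(U ** A ** adjoint_mat U) \<bullet> (U ** B ** adjoint_mat U) = A \<bullet> B"
proof -
  have "(U ** A ** adjoint_mat U) \<bullet> (U ** B ** adjoint_mat U) =
      (A ** adjoint_mat U) \<bullet> (B ** adjoint_mat U)"
    unfolding matrix_mul_assoc[symmetric] inner_matrix_mult_left[of U] unitary_cancel[OF assms] ..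
  also have "\<dots> = A \<bullet> B"
    by (simp add: inner_matrix_mult_right matrix_mul_assoc[symmetric] unitaryD[OF assms])
  finally show ?thesis .
qed

text \<open>The squared moduli of the overlaps of the two eigenbases form a doubly stochastic matrix. The
  case where one of the spectra is constantly 1 gives its row and column sums.\<close>

lemma inner_spec_mat:
  "spec_mat U d \<bullet> spec_mat V e =
    (\<Sum>i\<in>UNIV. \<Sum>j\<in>UNIV. d i * e j * (cmod ((adjoint_mat U ** V) $ i $ j))\<^sup>2)"
proof -
  define W where "W = adjoint_mat U ** V"
  have "spec_mat U d \<bullet> spec_mat V e = real_diag d \<bullet> (W ** real_diag e ** adjoint_mat W)"
    unfolding spec_mat_def inner_matrix_mult_right[of "U ** real_diag d"] inner_matrix_mult_left[of U]
    by (simp add: W_def adjoint_mat_mult matrix_mul_assoc)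
  also have "\<dots> = (\<Sum>i\<in>UNIV. of_real (d i) \<bullet> (W ** real_diag e ** adjoint_mat W) $ i $ i)"
    unfolding inner_vec_def
    by (simp add: if_distrib[of "\<lambda>x. x \<bullet> _"] cong: if_cong)
  also have "\<dots> = (\<Sum>i\<in>UNIV. \<Sum>j\<in>UNIV. d i * e j * (cmod (W $ i $ j))\<^sup>2)"
  proof (rule sum.cong[OF refl])
    fix i
    have "(W ** real_diag e ** adjoint_mat W) $ i $ i = (\<Sum>j\<in>UNIV. of_real (e j * (cmod (W $ i $ j))\<^sup>2))"
      unfolding matrix_matrix_mult_def[of "W ** real_diag e"]
      by (simp add: real_diag_mult_right_nth complex_norm_square[symmetric] scaleR_conv_of_real[where 'a = complex] mult.assoc)
    then show "of_real (d i) \<bullet> (W ** real_diag e ** adjoint_mat W) $ i $ i =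
        (\<Sum>j\<in>UNIV. d i * e j * (cmod (W $ i $ j))\<^sup>2)"
      by (simp add: inner_complex_def sum_distrib_left mult.assoc)
  qed
  finally show ?thesis unfolding W_def .
qed

lemma quadratic_form_spec_mat:
  "x \<bullet> (spec_mat U d *v x) = (\<Sum>i\<in>UNIV. d i * (cmod ((adjoint_mat U *v x) $ i))\<^sup>2)"
proof -
  define y where "y = adjoint_mat U *v x"
  have "x \<bullet> (spec_mat U d *v x) = y \<bullet> (real_diag d *v y)"
    by (simp add: spec_mat_def matrix_vector_mul_assoc[symmetric] y_def inner_matrix_vector[of x U])
  also have "\<dots> = (\<Sum>i\<in>UNIV. d i * (cmod (y $ i))\<^sup>2)"
  proof -
    have "(real_diag d *v y) $ i = d i *\<^sub>R y $ i" for i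
      by (simp add: matrix_vector_mult_def if_distrib[of "\<lambda>x. x * _"]
          scaleR_conv_of_real[where 'a = complex] cong: if_cong)
    then show ?thesis by (simp add: inner_vec_def power2_norm_eq_inner)
  qed
  finally show ?thesis unfolding y_def .
qed

lemma inner_self_unitary:
  assumes "unitary U"
  shows "x \<bullet> x = (\<Sum>i\<in>UNIV. (cmod ((adjoint_mat U *v x) $ i))\<^sup>2)"
  using quadratic_form_spec_mat[of x U "\<lambda>_. 1"] by (simp add: spec_mat_const[OF assms])

lemma spec_mat_eigenvalue:
  assumes "unitary U"
  obtains x where "x \<bullet> x = 1" "x \<bullet> (spec_mat U d *v x) = d i"
proof
  define x where "x = U *v axis i 1"
  have x: "adjoint_mat U *v x = axis i 1"
    by (simp add: x_def matrix_vector_mul_assoc unitaryD[OF assms])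
  have ax: "(cmod (axis i 1 $ j))\<^sup>2 = (if j = i then 1 else 0)" for j :: 'a
    by (simp add: axis_def)
  show "x \<bullet> x = 1" by (simp add: inner_self_unitary[OF assms] x ax)
  show "x \<bullet> (spec_mat U d *v x) = d i"
    by (simp add: quadratic_form_spec_mat x ax if_distrib[of "\<lambda>x. _ * x"] cong: if_cong)
qed

text \<open>The functional calculus is defined by a description over all diagonalisations, so this rests on
  their giving the same result.\<close>

lemma mat_fun_spec_mat:
  assumes U: "unitary U"
  shows "mat_fun g (spec_mat U d) = spec_mat U (\<lambda>i. g (d i))"
  unfolding mat_fun_def spec_mat_def[symmetric]
proof (rule the_equality)
  show "\<exists>V e. unitary V \<and> spec_mat U d = spec_mat V e \<and>
      spec_mat U (\<lambda>i. g (d i)) = spec_mat V (\<lambda>i. g (e i))"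
    using U by blast
next
  fix B assume "\<exists>V e. unitary V \<and> spec_mat U d = spec_mat V e \<and> B = spec_mat V (\<lambda>i. g (e i))"
  then obtain V e where V: "unitary V" and eq: "spec_mat U d = spec_mat V e"
    and B: "B = spec_mat V (\<lambda>i. g (e i))" by blast
  define W where "W = adjoint_mat V ** U"
  have intertwine: "W ** real_diag a = real_diag b ** W"
    if "spec_mat U a = spec_mat V b" for a b
  proof -
    have "adjoint_mat V ** spec_mat U a ** U = adjoint_mat V ** spec_mat V b ** U"
      by (simp add: that)
    then show ?thesis
      by (simp add: spec_mat_def W_def matrix_mul_assoc[symmetric] unitaryD[OF U]
          unitary_cancel[OF V])
  qed
  (* W intertwines the two diagonal matrices, so an entry of W vanishes unless it joins equal
     eigenvalues; hence W intertwines their images under g as well. *)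
  have "d j *\<^sub>R W $ i $ j = e i *\<^sub>R W $ i $ j" for i j
    using intertwine[OF eq]
    by (metis real_diag_mult_left_nth real_diag_mult_right_nth)
  then have "g (d j) *\<^sub>R W $ i $ j = g (e i) *\<^sub>R W $ i $ j" for i j
    by (metis scaleR_cancel_right)
  then have "W ** real_diag (\<lambda>i. g (d i)) = real_diag (\<lambda>i. g (e i)) ** W"
    by (simp add: vec_eq_iff real_diag_mult_left_nth real_diag_mult_right_nth)
  then have "V ** (W ** real_diag (\<lambda>i. g (d i))) ** adjoint_mat U =
      V ** (real_diag (\<lambda>i. g (e i)) ** W) ** adjoint_mat U" by simp
  then show "B = spec_mat U (\<lambda>i. g (d i))"
    by (simp add: B spec_mat_def W_def matrix_mul_assoc[symmetric] unitaryD[OF U]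
        unitary_cancel[OF V])
qed

lemma mat_powr_spec_mat:
  "unitary U \<Longrightarrow> mat_powr (spec_mat U d) s = spec_mat U (\<lambda>i. d i powr s)"
  unfolding mat_powr_def by (rule mat_fun_spec_mat)

lemma hermitian_mat_powr:
  assumes "hermitian M"
  shows "hermitian (mat_powr M s)"
proof -
  obtain U d where "unitary U" "M = spec_mat U d"
    using assms hermitian_imp_spec_mat by blast
  then show ?thesis by (simp add: mat_powr_spec_mat hermitian_spec_mat)
qed

section \<open>Scalar bounds in the Loewner order\<close>

lemma hermitian_scaleR_1: "hermitian (c *\<^sub>R mat 1)"
  by (simp add: hermitian_def vec_eq_iff mat_def)

lemma hermitian_add: "hermitian A \<Longrightarrow> hermitian B \<Longrightarrow> hermitian (A + B)"
  and hermitian_diff: "hermitian A \<Longrightarrow> hermitian B \<Longrightarrow> hermitian (A - B)"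
  and hermitian_scaleR: "hermitian A \<Longrightarrow> hermitian (c *\<^sub>R A)"
  by (simp_all add: hermitian_def vec_eq_iff)

lemma quadratic_form_scalar: "x \<bullet> ((c *\<^sub>R mat 1 :: complex^'n^'n) *v x) = c * (x \<bullet> x)"
proof -
  have "(c *\<^sub>R mat 1 :: complex^'n^'n) *v x = c *\<^sub>R x"
    by (simp add: vec_eq_iff matrix_vector_mult_def mat_def scaleR_conv_of_real[where 'a = complex]
        if_distrib[of "\<lambda>x. _ * x"] if_distrib[of "\<lambda>x. x * _"] cong: if_cong)
  then show ?thesis by simp
qed

lemma scalar_loewner_le_iff:
  assumes "hermitian A"
  shows "loewner_le (c *\<^sub>R mat 1) A \<longleftrightarrow> (\<forall>x. c * (x \<bullet> x) \<le> x \<bullet> (A *v x))"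
  using assms
  by (simp add: loewner_le_def pos_semidef_def hermitian_diff hermitian_scaleR_1
      matrix_vector_mult_diff_rdistrib inner_diff_right quadratic_form_scalar)

lemma loewner_le_scalar_iff:
  assumes "hermitian A"
  shows "loewner_le A (c *\<^sub>R mat 1) \<longleftrightarrow> (\<forall>x. x \<bullet> (A *v x) \<le> c * (x \<bullet> x))"
  using assms
  by (simp add: loewner_le_def pos_semidef_def hermitian_diff hermitian_scaleR_1
      matrix_vector_mult_diff_rdistrib inner_diff_right quadratic_form_scalar)

lemma scalar_loewner_le_spec_mat_iff:
  assumes "unitary U"
  shows "loewner_le (c *\<^sub>R mat 1) (spec_mat U d) \<longleftrightarrow> (\<forall>i. c \<le> d i)"
proof
  assume *: "loewner_le (c *\<^sub>R mat 1) (spec_mat U d)"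
  show "\<forall>i. c \<le> d i"
  proof
    fix i
    obtain x where "x \<bullet> x = 1" "x \<bullet> (spec_mat U d *v x) = d i"
      using spec_mat_eigenvalue[OF assms] by blast
    with * show "c \<le> d i"
      unfolding scalar_loewner_le_iff[OF hermitian_spec_mat] by (metis mult.right_neutral)
  qed
next
  assume "\<forall>i. c \<le> d i"
  then show "loewner_le (c *\<^sub>R mat 1) (spec_mat U d)"
    unfolding scalar_loewner_le_iff[OF hermitian_spec_mat]
    by (auto simp: quadratic_form_spec_mat inner_self_unitary[OF assms] sum_distrib_left
        intro!: sum_mono mult_right_mono)
qed

lemma spec_mat_loewner_le_scalar_iff:
  assumes "unitary U"
  shows "loewner_le (spec_mat U d) (c *\<^sub>R mat 1) \<longleftrightarrow> (\<forall>i. d i \<le> c)"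
proof
  assume *: "loewner_le (spec_mat U d) (c *\<^sub>R mat 1)"
  show "\<forall>i. d i \<le> c"
  proof
    fix i
    obtain x where "x \<bullet> x = 1" "x \<bullet> (spec_mat U d *v x) = d i"
      using spec_mat_eigenvalue[OF assms] by blast
    with * show "d i \<le> c"
      unfolding loewner_le_scalar_iff[OF hermitian_spec_mat] by (metis mult.right_neutral)
  qed
next
  assume "\<forall>i. d i \<le> c"
  then show "loewner_le (spec_mat U d) (c *\<^sub>R mat 1)"
    unfolding loewner_le_scalar_iff[OF hermitian_spec_mat]
    by (auto simp: quadratic_form_spec_mat inner_self_unitary[OF assms] sum_distrib_left
        intro!: sum_mono mult_right_mono)
qed

lemma scalar_loewner_le_imp_pos_def:
  assumes "hermitian A" "0 < c" "loewner_le (c *\<^sub>R mat 1) A"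
  shows "pos_def A"
  unfolding pos_def_def
proof (intro conjI allI impI)
  fix x :: "complex^'a" assume "x \<noteq> 0"
  then have "0 < c * (x \<bullet> x)" using assms(2) by simp
  also have "\<dots> \<le> x \<bullet> (A *v x)" using assms by (simp add: scalar_loewner_le_iff)
  finally show "0 < x \<bullet> (A *v x)" .
qed (fact assms(1))

lemma pos_def_spec_mat_iff:
  assumes "unitary U"
  shows "pos_def (spec_mat U d) \<longleftrightarrow> (\<forall>i. 0 < d i)"
proof
  assume *: "pos_def (spec_mat U d)"
  show "\<forall>i. 0 < d i"
  proof
    fix i
    obtain x where "x \<bullet> x = 1" "x \<bullet> (spec_mat U d *v x) = d i"
      using spec_mat_eigenvalue[OF assms] by blast
    with * show "0 < d i" unfolding pos_def_def by (metis inner_zero_left zero_neq_one)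
  qed
next
  assume d: "\<forall>i. 0 < d i"
  have "0 < Min (range d)" using d by simp
  moreover have "loewner_le (Min (range d) *\<^sub>R mat 1) (spec_mat U d)"
    by (simp add: scalar_loewner_le_spec_mat_iff[OF assms])
  ultimately show "pos_def (spec_mat U d)"
    using scalar_loewner_le_imp_pos_def hermitian_spec_mat by blast
qed

lemma pos_def_imp_scalar_loewner_le:
  assumes "pos_def A"
  obtains c where "0 < c" "loewner_le (c *\<^sub>R mat 1) A"
proof -
  obtain U d where U: "unitary U" and A: "A = spec_mat U d"
    using assms hermitian_imp_spec_mat unfolding pos_def_def by metis
  have "0 < Min (range d)" using assms by (simp add: A pos_def_spec_mat_iff[OF U])
  moreover have "loewner_le (Min (range d) *\<^sub>R mat 1) A"
    by (simp add: A scalar_loewner_le_spec_mat_iff[OF U])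
  ultimately show ?thesis using that by blast
qed

lemma norm_spec_mat:
  assumes "unitary U"
  shows "(norm (spec_mat U d))\<^sup>2 = (\<Sum>i\<in>UNIV. (d i)\<^sup>2)"
proof -
  have "(cmod (mat 1 $ i $ j))\<^sup>2 = (if i = j then 1 else 0)" for i j :: 'a
    by (simp add: mat_def)
  then show ?thesis
    by (simp add: power2_norm_eq_inner inner_spec_mat unitaryD[OF assms]
        power2_eq_square[of "d _"] if_distrib[of "\<lambda>x. _ * x"] cong: if_cong)
qed

text \<open>The crude factor \<open>CARD('n)\<close> instead of its square root costs nothing, as the estimates below
  are used only qualitatively.\<close>

lemma norm_spec_mat_le:
  fixes U :: "complex^'n^'n"
  assumes "unitary U" "\<And>i. \<bar>d i\<bar> \<le> c"
  shows "norm (spec_mat U d) \<le> real CARD('n) * c"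
proof -
  have c: "0 \<le> c" using assms(2) abs_ge_zero order_trans by blast
  have "(norm (spec_mat U d))\<^sup>2 \<le> (\<Sum>i\<in>(UNIV::'n set). c\<^sup>2)"
    unfolding norm_spec_mat[OF assms(1)] using assms(2) c
    by (intro sum_mono) (simp add: abs_le_square_iff[symmetric])
  also have "\<dots> \<le> real CARD('n) * (real CARD('n) * c\<^sup>2)"
  proof -
    have "1 * c\<^sup>2 \<le> real CARD('n) * c\<^sup>2"
      by (intro mult_right_mono) (simp_all add: Suc_le_eq)
    then show ?thesis by simp
  qed
  finally have "(norm (spec_mat U d))\<^sup>2 \<le> (real CARD('n) * c)\<^sup>2"
    by (simp add: power2_eq_square algebra_simps)
  then show ?thesis using c by (simp add: power2_le_iff_abs_le)
qed

lemma quadratic_form_le_norm: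
  assumes "hermitian H"
  shows "\<bar>x \<bullet> (H *v x)\<bar> \<le> norm H * (x \<bullet> x)"
proof -
  obtain U d where U: "unitary U" and H: "H = spec_mat U d"
    using assms hermitian_imp_spec_mat by blast
  have d: "\<bar>d i\<bar> \<le> norm H" for i
  proof -
    have "(d i)\<^sup>2 \<le> (\<Sum>i\<in>UNIV. (d i)\<^sup>2)" by (rule member_le_sum) auto
    then have "\<bar>d i\<bar>\<^sup>2 \<le> (norm H)\<^sup>2" by (simp add: H norm_spec_mat[OF U])
    then show ?thesis by (rule power2_le_imp_le) simp
  qed
  have "\<bar>x \<bullet> (H *v x)\<bar> \<le> (\<Sum>i\<in>UNIV. \<bar>d i * (cmod ((adjoint_mat U *v x) $ i))\<^sup>2\<bar>)"
    unfolding H quadratic_form_spec_mat by (rule sum_abs)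
  also have "\<dots> \<le> norm H * (x \<bullet> x)"
    unfolding inner_self_unitary[OF U] sum_distrib_left
    using d by (intro sum_mono) (simp add: abs_mult mult_right_mono)
  finally show ?thesis .
qed

lemma scalar_loewner_le_perturb:
  assumes "hermitian Z" "hermitian H" "loewner_le (c *\<^sub>R mat 1) Z"
  shows "loewner_le ((c - norm H) *\<^sub>R mat 1) (Z + H)"
  unfolding scalar_loewner_le_iff[OF hermitian_add[OF assms(1,2)]]
proof
  fix x
  have "c * (x \<bullet> x) \<le> x \<bullet> (Z *v x)" using assms by (simp add: scalar_loewner_le_iff)
  moreover have "- (norm H * (x \<bullet> x)) \<le> x \<bullet> (H *v x)"
    using quadratic_form_le_norm[OF assms(2), of x] by linarith
  ultimately show "(c - norm H) * (x \<bullet> x) \<le> x \<bullet> ((Z + H) *v x)"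
    by (simp add: matrix_vector_mult_add_rdistrib inner_add_right algebra_simps)
qed

section \<open>Inverses of positive definite matrices\<close>

lemma matrix_inv_eqI:
  fixes A B :: "complex^'n^'n"
  assumes "A ** B = mat 1" "B ** A = mat 1"
  shows "matrix_inv A = B"
proof -
  have *: "A ** matrix_inv A = mat 1 \<and> matrix_inv A ** A = mat 1"
    unfolding matrix_inv_def by (rule someI[of _ B]) (simp add: assms)
  have "matrix_inv A = (B ** A) ** matrix_inv A" by (simp add: assms(2))
  also have "\<dots> = B ** (A ** matrix_inv A)" by (rule matrix_mul_assoc[symmetric])
  also have "\<dots> = B" using * by simp
  finally show ?thesis .
qed

lemma matrix_inv_spec_mat:
  assumes "unitary U" "\<And>i. d i \<noteq> 0"
  shows "matrix_inv (spec_mat U d) = spec_mat U (\<lambda>i. 1 / d i)"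
  by (rule matrix_inv_eqI) (simp_all add: spec_mat_mult assms spec_mat_const)

lemma pos_def_matrix_inv:
  assumes "pos_def Z"
  shows "Z ** matrix_inv Z = mat 1" "matrix_inv Z ** Z = mat 1" "hermitian (matrix_inv Z)"
proof -
  obtain U d where U: "unitary U" and Z: "Z = spec_mat U d"
    using assms hermitian_imp_spec_mat unfolding pos_def_def by metis
  have d: "d i \<noteq> 0" for i using assms pos_def_spec_mat_iff[OF U] unfolding Z by (metis less_irrefl)
  show "Z ** matrix_inv Z = mat 1" "matrix_inv Z ** Z = mat 1" "hermitian (matrix_inv Z)"
    unfolding Z matrix_inv_spec_mat[OF U d]
    by (simp_all add: spec_mat_mult[OF U] d spec_mat_const[OF U] hermitian_spec_mat)
qed

lemma norm_matrix_inv_le: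
  fixes Z :: "complex^'n^'n"
  assumes "hermitian Z" "0 < c" "loewner_le (c *\<^sub>R mat 1) Z"
  shows "norm (matrix_inv Z) \<le> real CARD('n) / c"
proof -
  obtain U d where U: "unitary U" and Z: "Z = spec_mat U d"
    using assms hermitian_imp_spec_mat by blast
  have d: "c \<le> d i" for i using assms(3) by (simp add: Z scalar_loewner_le_spec_mat_iff[OF U])
  then have "0 < d i" for i using assms(2) less_le_trans by blast
  then have d0: "d i \<noteq> 0" and "\<bar>1 / d i\<bar> \<le> 1 / c" for i
    using d[of i] assms(2) by (auto simp: less_imp_neq frac_le order_less_imp_not_eq2)
  then show ?thesis
    unfolding Z matrix_inv_spec_mat[OF U d0] using norm_spec_mat_le[OF U, of "\<lambda>i. 1 / d i" "1 / c"]
    by simp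
qed

text \<open>In an eigenbasis of \<open>Z\<close> with eigenvalues \<open>z\<close>, the form \<open>tr (Z\<^sup>-\<^sup>1 Y Z\<^sup>-\<^sup>1 Y)\<close> is the
  sum of \<open>\<bar>Y\<^sub>i\<^sub>j\<bar>\<^sup>2 / (z\<^sub>i z\<^sub>j)\<close>, so scalar bounds for \<open>Z\<close> bound it by multiples of
  \<open>tr Y\<^sup>2\<close>.\<close>

lemma inner_sandwich_matrix_inv:
  assumes "hermitian Z" "0 < a" "loewner_le (a *\<^sub>R mat 1) Z" "loewner_le Z (b *\<^sub>R mat 1)"
  shows "Y \<bullet> Y / b\<^sup>2 \<le> (matrix_inv Z ** Y ** matrix_inv Z) \<bullet> Y"
    and "(matrix_inv Z ** Y ** matrix_inv Z) \<bullet> Y \<le> Y \<bullet> Y / a\<^sup>2"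
proof -
  obtain U z where U: "unitary U" and Z: "Z = spec_mat U z"
    using assms hermitian_imp_spec_mat by blast
  have az: "a \<le> z i" and zb: "z i \<le> b" for i
    using assms(3,4)
    by (simp_all add: Z scalar_loewner_le_spec_mat_iff[OF U] spec_mat_loewner_le_scalar_iff[OF U])
  have z: "0 < z i" for i using az assms(2) less_le_trans by blast
  then have z0: "z i \<noteq> 0" for i by (metis less_irrefl)
  define W where "W = adjoint_mat U ** Y ** U"
  have Y: "Y = U ** W ** adjoint_mat U"
    by (simp add: W_def matrix_mul_assoc[symmetric] unitaryD[OF U] unitary_cancel[OF U])
  define r where "r = (\<lambda>i. 1 / z i)"
  have inner_W: "A \<bullet> W = (\<Sum>i\<in>UNIV. \<Sum>j\<in>UNIV. A $ i $ j \<bullet> W $ i $ j)" for A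
    by (simp add: inner_vec_def)
  have "matrix_inv Z ** Y ** matrix_inv Z =
      U ** (real_diag r ** W ** real_diag r) ** adjoint_mat U"
    unfolding Z matrix_inv_spec_mat[OF U z0] r_def
    by (simp add: spec_mat_def Y matrix_mul_assoc[symmetric] unitary_cancel[OF U])
  then have "(matrix_inv Z ** Y ** matrix_inv Z) \<bullet> Y = (real_diag r ** W ** real_diag r) \<bullet> W"
    by (metis Y inner_unitary_conj[OF U])
  also have "\<dots> = (\<Sum>i\<in>UNIV. \<Sum>j\<in>UNIV. (r i * r j) * (W $ i $ j \<bullet> W $ i $ j))"
    unfolding inner_W
    by (simp add: real_diag_mult_right_nth real_diag_mult_left_nth mult_ac)
  finally have E: "(matrix_inv Z ** Y ** matrix_inv Z) \<bullet> Y =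
    (\<Sum>i\<in>UNIV. \<Sum>j\<in>UNIV. (r i * r j) * (W $ i $ j \<bullet> W $ i $ j))" .
  have YY: "Y \<bullet> Y / c\<^sup>2 = (\<Sum>i\<in>UNIV. \<Sum>j\<in>UNIV. (1 / c * (1 / c)) * (W $ i $ j \<bullet> W $ i $ j))" for c
    by (simp add: Y inner_unitary_conj[OF U] inner_W sum_divide_distrib power2_eq_square)
  have "1 / b \<le> r i" "r i \<le> 1 / a" "0 < r i" "0 < b" for i
    using az[of i] zb[of i] z[of i] assms(2) by (simp_all add: r_def frac_le)
  then have "1 / b * (1 / b) \<le> r i * r j" "r i * r j \<le> 1 / a * (1 / a)" for i j
    by (intro mult_mono; use assms(2) in \<open>auto intro: less_imp_le\<close>)+
  then show "Y \<bullet> Y / b\<^sup>2 \<le> (matrix_inv Z ** Y ** matrix_inv Z) \<bullet> Y"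
    "(matrix_inv Z ** Y ** matrix_inv Z) \<bullet> Y \<le> Y \<bullet> Y / a\<^sup>2"
    unfolding E YY by (intro sum_mono mult_right_mono; simp)+
qed

text \<open>The resolvent identity \<open>R - R' = R' H R\<close>, applied twice, gives the first-order expansion of the
  inverse with an exact remainder.\<close>

lemma matrix_inv_expansion:
  fixes Z H :: "complex^'n^'n"
  assumes "pos_def Z" "pos_def (Z + H)"
  defines "R \<equiv> matrix_inv Z" and "R' \<equiv> matrix_inv (Z + H)"
  shows "R' - R + R ** H ** R = R' ** H ** R ** H ** R"
proof -
  have "R' ** H ** R = R' ** ((Z + H) - Z) ** R" by simp
  also have "\<dots> = R' ** (Z + H) ** R - R' ** (Z ** R)"
    unfolding matmul.diff_left matmul.diff_right matrix_mul_assoc ..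
  also have "\<dots> = R - R'"
    using pos_def_matrix_inv[OF assms(1)] pos_def_matrix_inv[OF assms(2)]
    by (simp add: R_def R'_def)
  finally have eq: "R - R' = R' ** H ** R" by simp
  have "R ** H ** R - R' ** H ** R = R' ** H ** R ** H ** R"
    using arg_cong[OF eq, of "\<lambda>X. X ** H ** R"] by (simp only: matmul.diff_left)
  then show ?thesis unfolding eq[symmetric] by (simp add: algebra_simps)
qed

section \<open>Concavity of the trace of a power\<close>

text \<open>Convexity of \<open>exp\<close> between \<open>ln (y / x)\<close> and 0 gives Bernoulli's inequality for \<open>y / x\<close>, which
  is the claim up to the factor \<open>x\<^bsup>t\<^esup>\<close>.\<close>

lemma powr_le_tangent:
  fixes x y t :: real
  assumes "0 < x" "0 < y" "0 < t" "t < 1"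
  shows "y powr t \<le> x powr t + t * x powr (t - 1) * (y - x)"
proof -
  have "exp (t * ln (y / x) + (1 - t) * 0) \<le> t * exp (ln (y / x)) + (1 - t) * exp 0"
    using convex_onD[OF exp_convex, of "1 - t" "ln (y / x)" 0] assms by simp
  then have "(y / x) powr t \<le> t * (y / x) + (1 - t)"
    using assms by (simp add: powr_def)
  then have "x powr t * (y / x) powr t \<le> x powr t * (t * (y / x) + (1 - t))"
    by (rule mult_left_mono) simp
  also have "x powr t * (y / x) powr t = y powr t"
    using assms by (simp add: powr_divide)
  also have "x powr t * (t * (y / x) + (1 - t)) = x powr t + t * x powr (t - 1) * (y - x)"
    using assms by (simp add: powr_diff field_simps)
  finally show ?thesis .
qed

text \<open>This is Klein's inequality for the function \<open>x\<^bsup>t\<^esup>\<close>. With \<open>p\<^sub>i\<^sub>j\<close> the squared moduli of the overlaps of the two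
  eigenbases, both sides are averages over \<open>p\<close> of the two sides of the scalar tangent inequality
  at the pairs of eigenvalues.\<close>

lemma trace_powr_le_tangent:
  fixes M M' :: "complex^'n^'n"
  assumes "pos_def M" "pos_def M'" "0 < t" "t < 1"
  shows "mat_powr M' t \<bullet> mat 1 \<le> mat_powr M t \<bullet> mat 1 + t * (mat_powr M (t - 1) \<bullet> (M' - M))"
proof -
  obtain U m where U: "unitary U" and M: "M = spec_mat U m"
    using assms hermitian_imp_spec_mat unfolding pos_def_def by metis
  obtain V n where V: "unitary V" and M': "M' = spec_mat V n"
    using assms hermitian_imp_spec_mat unfolding pos_def_def by metis
  have m: "0 < m i" and n: "0 < n i" for i
    using assms by (simp_all add: M M' pos_def_spec_mat_iff U V)
  define p where "p = (\<lambda>i j. (cmod ((adjoint_mat U ** V) $ i $ j))\<^sup>2)"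
  define D where "D = (\<lambda>d e. \<Sum>i\<in>UNIV. \<Sum>j\<in>UNIV. d i * e j * p i j)"
  have D: "spec_mat U d \<bullet> spec_mat V e = D d e" for d e
    unfolding D_def p_def by (rule inner_spec_mat)
  (* Every trace and inner product in the claim is a p-average; the identity contributes the
     constant spectrum 1 in either eigenbasis. *)
  have one: "mat 1 = spec_mat U (\<lambda>_. 1)" "mat 1 = spec_mat V (\<lambda>_. 1)"
    by (simp_all add: spec_mat_const U V)
  have Uself: "spec_mat U d \<bullet> spec_mat U e = D (\<lambda>i. d i * e i) (\<lambda>_. 1)" for d e
  proof -
    have "spec_mat U d \<bullet> spec_mat U e = (spec_mat U d ** spec_mat U e) \<bullet> mat 1"
      using hermitian_spec_mat[of U e] by (simp add: inner_matrix_mult_right hermitian_def)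
    then show ?thesis by (metis D one(2) spec_mat_mult[OF U])
  qed
  have "mat_powr M' t \<bullet> mat 1 = D (\<lambda>_. 1) (\<lambda>j. n j powr t)"
    unfolding M' mat_powr_spec_mat[OF V] by (metis D one(1) inner_commute)
  also have "\<dots> \<le> D (\<lambda>i. m i powr t) (\<lambda>_. 1) + t * (D (\<lambda>i. m i powr (t - 1)) n
      - D (\<lambda>i. m i powr (t - 1) * m i) (\<lambda>_. 1))"
  proof -
    have "n j powr t * p i j \<le> m i powr t * p i j +
        t * (m i powr (t - 1) * n j * p i j - m i powr (t - 1) * m i * p i j)" for i j
    proof -
      have "n j powr t * p i j \<le> (m i powr t + t * m i powr (t - 1) * (n j - m i)) * p i j"
        by (intro mult_right_mono powr_le_tangent m n assms) (simp add: p_def)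
      then show ?thesis by (simp add: algebra_simps)
    qed
    then have "(\<Sum>i\<in>UNIV. \<Sum>j\<in>UNIV. n j powr t * p i j) \<le> (\<Sum>i\<in>UNIV. \<Sum>j\<in>UNIV. m i powr t * p i j +
        t * (m i powr (t - 1) * n j * p i j - m i powr (t - 1) * m i * p i j))"
      by (intro sum_mono)
    then show ?thesis
      by (simp add: D_def sum.distrib sum_distrib_left[symmetric] sum_subtractf)
  qed
  also have "D (\<lambda>i. m i powr t) (\<lambda>_. 1) = mat_powr M t \<bullet> mat 1"
    unfolding M mat_powr_spec_mat[OF U] by (metis D one(2))
  also have "D (\<lambda>i. m i powr (t - 1)) n - D (\<lambda>i. m i powr (t - 1) * m i) (\<lambda>_. 1) =
      mat_powr M (t - 1) \<bullet> (M' - M)"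
    unfolding M mat_powr_spec_mat[OF U] M' inner_diff_right D Uself ..
  finally show ?thesis .
qed

section \<open>An integral representation of powers\<close>

text \<open>The classical formula \<open>x\<^bsup>t-1\<^esup> = c \<integral> s\<^bsup>t-1\<^esup> / (x + s) ds\<close> over the positive half-line is used
  after the substitution \<open>s = exp u\<close>: all integrands are then smooth on the whole line, and rescaling
  \<open>s\<close> becomes a translation of \<open>u\<close>.\<close>

text \<open>With \<open>k = min t (1 - t)\<close>, the kernel is at most \<open>exp (- k \<bar>u\<bar>)\<close>, which up to constants is the
  derivative of \<open>arctan (exp (k u))\<close>, a function with finite limits at both ends.\<close>

lemma integrable_exp_kernel:
  fixes t :: real
  assumes "0 < t" "t < 1"
  shows "integrable lborel (\<lambda>u. exp (t * u) / (1 + exp u))"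
proof -
  define k where "k = min t (1 - t)"
  have k: "0 < k" "k \<le> t" "k \<le> 1 - t" using assms by (auto simp: k_def)
  define f where "f = (\<lambda>u::real. k * exp (k * u) / (1 + (exp (k * u))\<^sup>2))"
  have "set_integrable lborel (einterval (-\<infinity>) \<infinity>) f"
  proof (rule interval_integral_FTC_nonneg)
    show "((\<lambda>u. arctan (exp (k * u))) has_real_derivative f x) (at x)" for x
      unfolding f_def by (auto intro!: derivative_eq_intros simp: field_simps)
    show "isCont f x" for x
      unfolding f_def
      by (intro continuous_intros) (metis add_pos_nonneg less_irrefl zero_le_power2 zero_less_one)
    show "AE x in lborel. -\<infinity> < ereal x \<longrightarrow> ereal x < \<infinity> \<longrightarrow> 0 \<le> f x"
      using k by (simp add: f_def)
    have "((\<lambda>u. exp (k * u)) \<longlongrightarrow> 0) at_bot"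
      using k by (intro filterlim_compose[OF exp_at_bot] filterlim_tendsto_pos_mult_at_bot[of "\<lambda>_. k" k])
        (auto simp: filterlim_ident)
    then have "((\<lambda>u. arctan (exp (k * u))) \<longlongrightarrow> arctan 0) at_bot"
      by (rule tendsto_arctan)
    then show "(((\<lambda>u. arctan (exp (k * u))) \<circ> real_of_ereal) \<longlongrightarrow> arctan 0) (at_right (-\<infinity>))"
      by (simp add: ereal_tendsto_simps)
    have "filterlim (\<lambda>u. exp (k * u)) at_top at_top"
      using k by (intro filterlim_compose[OF exp_at_top] filterlim_tendsto_pos_mult_at_top[of "\<lambda>_. k" k])
        (auto simp: filterlim_ident)
    then have "((\<lambda>u. arctan (exp (k * u))) \<longlongrightarrow> pi / 2) at_top"
      by (rule filterlim_compose[OF tendsto_arctan_at_top])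
    then show "(((\<lambda>u. arctan (exp (k * u))) \<circ> real_of_ereal) \<longlongrightarrow> pi / 2) (at_left \<infinity>)"
      by (simp add: ereal_tendsto_simps)
  qed simp
  then have f: "integrable lborel f"
    by (simp add: set_integrable_def einterval_def)
  show ?thesis
  proof (rule Bochner_Integration.integrable_bound[OF integrable_mult_right[OF f, of "2 / k"]])
    show "AE u in lborel. norm (exp (t * u) / (1 + exp u)) \<le> norm (2 / k * f u)"
    proof (rule AE_I2)
      fix u :: real
      define a where "a = exp (k * u)"
      define b where "b = exp ((1 + k) * u)"
      have ab: "0 < a" "0 < b" by (simp_all add: a_def b_def)
      have between: "exp (p * u) \<le> a + b" if "k \<le> p" "p \<le> 1 + k" for p
      proof (cases "0 \<le> u")
        case True
        then have "exp (p * u) \<le> b" using that by (simp add: b_def mult_right_mono)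
        then show ?thesis using ab by simp
      next
        case False
        then have "exp (p * u) \<le> a" using that by (simp add: a_def mult_right_mono_neg)
        then show ?thesis using ab by simp
      qed
      have "exp (t * u) * (1 + a\<^sup>2) = exp (t * u) + exp ((t + 2 * k) * u)"
        by (simp add: a_def power2_eq_square exp_add[symmetric] algebra_simps)
      also have "\<dots> \<le> 2 * (a + b)"
        using between[of t] between[of "t + 2 * k"] k assms by simp
      also have "\<dots> = 2 * a * (1 + exp u)"
        by (simp add: a_def b_def exp_add[symmetric] algebra_simps)
      finally have le: "exp (t * u) * (1 + a\<^sup>2) \<le> 2 * a * (1 + exp u)" .
      have pos: "0 < 1 + exp u" "0 < 1 + a\<^sup>2" by (simp_all add: add_pos_nonneg)
      have "exp (t * u) / (1 + exp u) \<le> 2 * a / (1 + a\<^sup>2)"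
        using le pos by (simp add: divide_le_eq le_divide_eq)
      moreover have "2 / k * f u = 2 * a / (1 + a\<^sup>2)"
        using k by (simp add: f_def a_def)
      ultimately show "norm (exp (t * u) / (1 + exp u)) \<le> norm (2 / k * f u)"
        using pos ab by (simp add: abs_of_pos)
    qed
  qed simp
qed

lemma integrable_exp_kernel_square:
  fixes t :: real
  assumes "0 < t" "t < 1"
  shows "integrable lborel (\<lambda>u. exp (t * u) / (1 + exp u)\<^sup>2)"
proof (rule Bochner_Integration.integrable_bound[OF integrable_exp_kernel[OF assms]])
  have "(1 + exp u) * 1 \<le> (1 + exp u) * (1 + exp u)" for u :: real
    by (intro mult_left_mono) (simp_all add: add_nonneg_nonneg)
  then show "AE u in lborel. norm (exp (t * u) / (1 + exp u)\<^sup>2) \<le> norm (exp (t * u) / (1 + exp u))"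
    by (auto simp: power2_eq_square abs_mult add_pos_pos intro!: divide_left_mono)
qed simp

text \<open>The value is \<open>\<pi> / sin (\<pi> t)\<close>; positivity is all that matters, because the constant cancels.\<close>

definition power_const :: "real \<Rightarrow> real" where
  "power_const t = (LBINT u. exp (t * u) / (1 + exp u))"

lemma power_const_pos:
  assumes "0 < t" "t < 1"
  shows "0 < power_const t"
proof -
  have "(LBINT u. exp (t * u) / (1 + exp u)) \<noteq> 0"
  proof
    assume "(LBINT u. exp (t * u) / (1 + exp u)) = 0"
    then have "AE u in lborel. exp (t * u) / (1 + exp u) = 0"
      by (subst (asm) integral_nonneg_eq_0_iff_AE[OF integrable_exp_kernel[OF assms]])
        (simp_all add: add_nonneg_nonneg)
    moreover have "exp (t * u) / (1 + exp u) \<noteq> 0" for u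
      using add_pos_pos[OF zero_less_one exp_gt_zero[of u]] by simp
    ultimately have "AE u in (lborel::real measure). False" by simp
    then show False by (simp add: eventually_False ae_filter_eq_bot_iff)
  qed
  moreover have "0 \<le> (LBINT u. exp (t * u) / (1 + exp u))"
    by (intro integral_nonneg_AE) (simp add: add_nonneg_nonneg)
  ultimately show ?thesis unfolding power_const_def by linarith
qed

text \<open>Integrating the derivative of \<open>exp (t u) / (1 + exp u)\<close> over the line relates the two
  integrals.\<close>

lemma integral_exp_kernel_square:
  assumes t: "0 < t" "t < 1"
  shows "(LBINT u. exp (t * u) / (1 + exp u)\<^sup>2) = (1 - t) * power_const t"
proof -
  let ?F = "\<lambda>u. exp (t * u) / (1 + exp u)"
  let ?f = "\<lambda>u. (t - 1) * (exp (t * u) / (1 + exp u)) + exp (t * u) / (1 + exp u)\<^sup>2"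
  have nz: "1 + exp u \<noteq> 0" for u :: real using exp_gt_zero[of u] by linarith
  have int: "integrable lborel ?f"
    by (intro Bochner_Integration.integrable_add integrable_mult_right integrable_exp_kernel
        integrable_exp_kernel_square t)
  have "(LBINT u=-\<infinity>..\<infinity>. ?f u) = 0 - 0"
  proof (rule interval_integral_FTC_integrable[where F = ?F])
    have "(?F has_real_derivative ?f x) (at x)" for x
      using nz[of x] by (auto intro!: derivative_eq_intros simp: divide_simps power2_eq_square)
        (simp add: algebra_simps)
    then show "(?F has_vector_derivative ?f x) (at x)" for x
      by (simp add: has_real_derivative_iff_has_vector_derivative)
    show "isCont ?f x" for x by (intro continuous_intros) (simp_all add: nz)
    show "set_integrable lborel (einterval (- \<infinity>) \<infinity>) ?f"
      using int by (simp add: set_integrable_def einterval_def)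
    have "((\<lambda>u. exp (t * u)) \<longlongrightarrow> 0) at_bot"
      using t by (intro filterlim_compose[OF exp_at_bot] filterlim_tendsto_pos_mult_at_bot[of "\<lambda>_. t" t])
        (auto simp: filterlim_ident)
    then have "(?F \<longlongrightarrow> 0) at_bot"
      by (rule Lim_null_comparison[rotated])
        (auto simp: field_simps add_pos_pos abs_of_pos intro!: always_eventually)
    then show "((?F \<circ> real_of_ereal) \<longlongrightarrow> 0) (at_right (-\<infinity>))"
      by (simp add: ereal_tendsto_simps)
    have "((\<lambda>u. exp ((t - 1) * u)) \<longlongrightarrow> 0) at_top"
      using t by (intro filterlim_compose[OF exp_at_bot] filterlim_tendsto_neg_mult_at_bot[of "\<lambda>_. t - 1" "t - 1"])
        (auto simp: filterlim_ident)
    moreover have "norm (?F u) \<le> exp ((t - 1) * u)" for u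
    proof -
      have "exp (t * u) = exp ((t - 1) * u) * exp u"
        by (simp add: exp_add[symmetric] algebra_simps)
      then show ?thesis by (simp add: divide_le_eq add_pos_pos abs_of_pos algebra_simps)
    qed
    ultimately have "(?F \<longlongrightarrow> 0) at_top"
      by (intro Lim_null_comparison[of ?F "\<lambda>u. exp ((t - 1) * u)"]) auto
    then show "((?F \<circ> real_of_ereal) \<longlongrightarrow> 0) (at_left \<infinity>)"
      by (simp add: ereal_tendsto_simps)
  qed simp
  then have "(LBINT u. ?f u) = 0"
    by (simp add: interval_lebesgue_integral_def set_lebesgue_integral_def einterval_def)
  moreover have "(LBINT u. ?f u) = (LBINT u. (t - 1) * (exp (t * u) / (1 + exp u))) +
      (LBINT u. exp (t * u) / (1 + exp u)\<^sup>2)"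
    by (intro Bochner_Integration.integral_add integrable_mult_right integrable_exp_kernel
        integrable_exp_kernel_square t)
  moreover have "(LBINT u. (t - 1) * (exp (t * u) / (1 + exp u))) = (t - 1) * power_const t"
    unfolding power_const_def by (rule integral_mult_right_zero)
  ultimately have "(t - 1) * power_const t + (LBINT u. exp (t * u) / (1 + exp u)\<^sup>2) = 0"
    by simp
  then show ?thesis by (simp add: algebra_simps)
qed

text \<open>Translating \<open>u\<close> by \<open>ln (x / a)\<close> reduces all the kernels to the one with \<open>x = a = 1\<close>.\<close>

lemma has_bochner_integral_exp_kernel_rescale:
  fixes t x a :: real
  assumes int: "integrable lborel (\<lambda>u. exp (t * u) / (1 + exp u) ^ k)" and x: "0 < x" "0 < a"
  shows "has_bochner_integral lborel (\<lambda>u. exp (t * u) / (x + a * exp u) ^ k)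
    (x powr (t - real k) * a powr (- t) * (LBINT u. exp (t * u) / (1 + exp u) ^ k))"
proof -
  define s where "s = ln x - ln a"
  have es: "exp s = x / a" using x by (simp add: s_def exp_diff)
  have "exp (t * (s + 1 * u)) / (x + a * exp (s + 1 * u)) ^ k =
      x powr (t - real k) * a powr (- t) * (exp (t * u) / (1 + exp u) ^ k)" for u
  proof -
    have "exp (t * (s + 1 * u)) = x powr t * a powr (- t) * exp (t * u)"
      using x by (simp add: s_def powr_def exp_add[symmetric] algebra_simps)
    moreover have "x + a * exp (s + 1 * u) = x * (1 + exp u)"
      using x by (simp add: exp_add es algebra_simps)
    ultimately show ?thesis
      using x by (simp add: power_mult_distrib powr_diff powr_realpow)
  qed
  moreover have "has_bochner_integral lborel
      (\<lambda>u. x powr (t - real k) * a powr (- t) * (exp (t * u) / (1 + exp u) ^ k))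
      (x powr (t - real k) * a powr (- t) * (LBINT u. exp (t * u) / (1 + exp u) ^ k))"
    by (intro has_bochner_integral_mult_right has_bochner_integral_integrable int)
  ultimately show ?thesis
    by (subst lborel_has_bochner_integral_real_affine_iff[of 1 _ _ s]) simp_all
qed

lemma has_bochner_integral_power:
  assumes "0 < t" "t < 1" "0 < x"
  shows "has_bochner_integral lborel (\<lambda>u. exp (t * u) / (x + exp u)) (x powr (t - 1) * power_const t)"
  using has_bochner_integral_exp_kernel_rescale[of t 1 x 1] integrable_exp_kernel assms
  by (simp add: power_const_def)

lemma has_bochner_integral_power_square:
  assumes "0 < t" "t < 1" "0 < x" "0 < a"
  shows "has_bochner_integral lborel (\<lambda>u. exp (t * u) / (x + a * exp u)\<^sup>2)
    (x powr (t - 2) * a powr (- t) * ((1 - t) * power_const t))"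
  using has_bochner_integral_exp_kernel_rescale[of t 2 x a] integrable_exp_kernel_square assms
  by (simp add: integral_exp_kernel_square)

section \<open>The integral of the resolvent and its derivative\<close>

abbreviation pencil_inv :: "complex^'n^'n \<Rightarrow> complex^'n^'n \<Rightarrow> real \<Rightarrow> complex^'n^'n" where
  "pencil_inv B X u \<equiv> matrix_inv (X + exp u *\<^sub>R B)"

lemma pos_def_congruence:
  assumes "hermitian C" "D ** C = mat 1" "pos_def X"
  shows "pos_def (C ** X ** C)"
  unfolding pos_def_def
proof (intro conjI allI impI)
  show "hermitian (C ** X ** C)"
    using assms by (simp add: hermitian_def pos_def_def adjoint_mat_mult matrix_mul_assoc)
  fix x :: "complex^'a" assume "x \<noteq> 0"
  then have "C *v x \<noteq> 0"
    using assms(2) by (metis matrix_vector_mul_assoc matrix_vector_mul_lid matrix_vector_mult_0_right)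
  then have "0 < (C *v x) \<bullet> (X *v (C *v x))" using assms(3) by (simp add: pos_def_def)
  also have "\<dots> = x \<bullet> ((C ** X ** C) *v x)"
    using assms(1)
    by (simp add: matrix_vector_mul_assoc[symmetric] inner_matrix_vector[of x C] hermitian_def)
  finally show "0 < x \<bullet> ((C ** X ** C) *v x)" .
qed

lemma loewner_le_pencil:
  assumes X: "hermitian X" and B: "hermitian B" and "0 \<le> s"
  shows "loewner_le (a *\<^sub>R mat 1) X \<Longrightarrow> loewner_le (b *\<^sub>R mat 1) B \<Longrightarrow>
      loewner_le ((a + b * s) *\<^sub>R mat 1) (X + s *\<^sub>R B)"
    and "loewner_le X (a *\<^sub>R mat 1) \<Longrightarrow> loewner_le B (b *\<^sub>R mat 1) \<Longrightarrow>
      loewner_le (X + s *\<^sub>R B) ((a + b * s) *\<^sub>R mat 1)"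
proof -
  have h: "hermitian (X + s *\<^sub>R B)" by (intro hermitian_add hermitian_scaleR X B)
  have q: "x \<bullet> ((X + s *\<^sub>R B) *v x) = x \<bullet> (X *v x) + s * (x \<bullet> (B *v x))" for x
  proof -
    have "(s *\<^sub>R B) *v x = s *\<^sub>R (B *v x)"
      by (simp add: vec_eq_iff matrix_vector_mult_def scaleR_right.sum)
    then show ?thesis by (simp add: matrix_vector_mult_add_rdistrib inner_add_right)
  qed
  show "loewner_le (a *\<^sub>R mat 1) X \<Longrightarrow> loewner_le (b *\<^sub>R mat 1) B \<Longrightarrow>
      loewner_le ((a + b * s) *\<^sub>R mat 1) (X + s *\<^sub>R B)"
    using \<open>0 \<le> s\<close>
    by (auto simp: scalar_loewner_le_iff[OF h] scalar_loewner_le_iff[OF X]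
        scalar_loewner_le_iff[OF B] q distrib_right mult.assoc mult.left_commute[of b]
        intro!: add_mono mult_left_mono)
  show "loewner_le X (a *\<^sub>R mat 1) \<Longrightarrow> loewner_le B (b *\<^sub>R mat 1) \<Longrightarrow>
      loewner_le (X + s *\<^sub>R B) ((a + b * s) *\<^sub>R mat 1)"
    using \<open>0 \<le> s\<close>
    by (auto simp: loewner_le_scalar_iff[OF h] loewner_le_scalar_iff[OF X]
        loewner_le_scalar_iff[OF B] q distrib_right mult.assoc mult.left_commute[of b]
        intro!: add_mono mult_left_mono)
qed

lemma norm_pencil_inv_le:
  fixes B X :: "complex^'n^'n"
  assumes "hermitian X" "hermitian B" "0 < c"
    and "loewner_le (c *\<^sub>R mat 1) X" "loewner_le (c *\<^sub>R mat 1) B"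
  shows "norm (pencil_inv B X u) \<le> real CARD('n) / c / (1 + exp u)"
proof -
  have "loewner_le ((c + c * exp u) *\<^sub>R mat 1) (X + exp u *\<^sub>R B)"
    by (intro loewner_le_pencil assms) simp
  then have "norm (pencil_inv B X u) \<le> real CARD('n) / (c + c * exp u)"
    by (intro norm_matrix_inv_le hermitian_add hermitian_scaleR assms) (simp add: add_pos_pos assms)
  then show ?thesis by (simp add: distrib_left)
qed

text \<open>With \<open>C\<close> and \<open>D\<close> mutually inverse, \<open>X + s D\<^sup>2 = D (C X C + s) D\<close>, so one spectral
  decomposition of \<open>C X C\<close> displays all the inverses at once as combinations of fixed matrices.\<close>

lemma pencil_inv_decomposition:
  fixes C D X :: "complex^'n^'n"
  assumes CD: "hermitian C" "C ** D = mat 1" "D ** C = mat 1" and X: "pos_def X"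
  obtains m :: "'n \<Rightarrow> real" and Q :: "'n \<Rightarrow> complex^'n^'n"
  where "\<And>i. 0 < m i"
    and "\<And>u. pencil_inv (D ** D) X u = (\<Sum>i\<in>UNIV. (1 / (m i + exp u)) *\<^sub>R Q i)"
    and "\<And>s. C ** mat_powr (C ** X ** C) s ** C = (\<Sum>i\<in>UNIV. m i powr s *\<^sub>R Q i)"
proof -
  have pd: "pos_def (C ** X ** C)" by (rule pos_def_congruence[OF CD(1,3) X])
  obtain U m where U: "unitary U" and M: "C ** X ** C = spec_mat U m"
    using pd hermitian_imp_spec_mat unfolding pos_def_def by metis
  have m: "0 < m i" for i using pd by (simp add: M pos_def_spec_mat_iff[OF U])
  define Q where "Q = (\<lambda>k. C ** spec_mat U (\<lambda>i. if i = k then 1 else 0) ** C)"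
  have Q: "C ** spec_mat U d ** C = (\<Sum>i\<in>UNIV. d i *\<^sub>R Q i)" for d
    by (subst spec_mat_eq_sum)
      (simp add: Q_def matmul.sum_left matmul.sum_right matmul.scaleR_left matmul.scaleR_right)
  have C_cancel: "C ** (D ** A) = A" "D ** (C ** A) = A" for A :: "complex^'n^'n"
    by (simp_all add: matrix_mul_assoc CD)
  have inv: "pencil_inv (D ** D) X u = C ** spec_mat U (\<lambda>i. 1 / (m i + exp u)) ** C" for u
  proof -
    define S where "S = spec_mat U (\<lambda>i. m i + exp u)"
    define T where "T = spec_mat U (\<lambda>i. 1 / (m i + exp u))"
    have "m i + exp u \<noteq> 0" for i using m[of i] exp_gt_zero[of u] by linarith
    then have ST: "S ** T = mat 1" "T ** S = mat 1"
      by (simp_all add: S_def T_def spec_mat_mult[OF U] spec_mat_const[OF U])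
    have "S = C ** X ** C + exp u *\<^sub>R mat 1"
      by (simp add: S_def spec_mat_add spec_mat_const[OF U] M)
    then have "D ** S ** D = X + exp u *\<^sub>R (D ** D)"
      by (simp add: matmul.add_left matmul.add_right matmul.scaleR_left matmul.scaleR_right
          matrix_mul_assoc[symmetric] C_cancel CD)
    moreover have "matrix_inv (D ** S ** D) = C ** T ** C"
    proof (rule matrix_inv_eqI)
      have "S ** (T ** A) = A" "T ** (S ** A) = A" for A :: "complex^'n^'n"
        by (simp_all add: matrix_mul_assoc ST)
      then show "D ** S ** D ** (C ** T ** C) = mat 1" "C ** T ** C ** (D ** S ** D) = mat 1"
        by (simp_all add: matrix_mul_assoc[symmetric] C_cancel CD)
    qed
    ultimately show ?thesis by (simp add: T_def)
  qed
  show ?thesis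
  proof (rule that)
    show "0 < m i" for i by (rule m)
    show "pencil_inv (D ** D) X u = (\<Sum>i\<in>UNIV. (1 / (m i + exp u)) *\<^sub>R Q i)" for u
      by (simp add: inv Q)
    show "C ** mat_powr (C ** X ** C) s ** C = (\<Sum>i\<in>UNIV. m i powr s *\<^sub>R Q i)" for s
      by (simp add: M mat_powr_spec_mat[OF U] Q)
  qed
qed

text \<open>The derivative has the form that differentiation under the integral sign predicts.\<close>

definition pencil_integral :: "real \<Rightarrow> complex^'n^'n \<Rightarrow> complex^'n^'n \<Rightarrow> complex^'n^'n" where
  "pencil_integral t B X = (LBINT u. exp (t * u) *\<^sub>R pencil_inv B X u)"

definition pencil_integral_deriv ::
  "real \<Rightarrow> complex^'n^'n \<Rightarrow> complex^'n^'n \<Rightarrow> complex^'n^'n \<Rightarrow> complex^'n^'n" where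
  "pencil_integral_deriv t B X Y =
     - (LBINT u. exp (t * u) *\<^sub>R (pencil_inv B X u ** Y ** pencil_inv B X u))"

text \<open>The matrix \<open>B = C\<^sup>-\<^sup>2\<close> is chosen so that \<open>C (C X C + s)\<^sup>-\<^sup>1 C = (X + s B)\<^sup>-\<^sup>1\<close>: the resolvents of
  \<open>C X C\<close> become inverses in which \<open>X\<close> and \<open>C\<close> enter separately, each with its own scalar
  bounds.\<close>

locale pencil =
  fixes t :: real and B C D :: "complex^'n^'n"
  assumes t: "0 < t" "t < 1"
    and C: "hermitian C" and D: "hermitian D" and CD: "C ** D = mat 1" "D ** C = mat 1"
    and B_def: "B = D ** D"
begin

lemma pos_def_B: "pos_def B"
  using pos_def_congruence[OF D CD(1), of "mat 1"] scalar_loewner_le_imp_pos_def[of "mat 1" 1]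
  by (simp add: B_def hermitian_def loewner_le_def pos_semidef_def vec_eq_iff)

lemma pos_def_pencil:
  assumes "pos_def X"
  shows "pos_def (X + exp u *\<^sub>R B)"
proof -
  obtain x where x: "0 < x" "loewner_le (x *\<^sub>R mat 1) X"
    using pos_def_imp_scalar_loewner_le[OF assms] .
  obtain b where b: "0 < b" "loewner_le (b *\<^sub>R mat 1) B"
    using pos_def_imp_scalar_loewner_le[OF pos_def_B] .
  have h: "hermitian X" "hermitian B" using assms pos_def_B by (auto simp: pos_def_def)
  have "0 < x + b * exp u" using x b by (simp add: add_pos_pos)
  then show ?thesis
    using loewner_le_pencil(1)[OF h _ x(2) b(2), of "exp u"] h
    by (intro scalar_loewner_le_imp_pos_def[of _ "x + b * exp u"] hermitian_add hermitian_scaleR) auto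
qed

lemma continuous_pencil_inv:
  assumes "pos_def X"
  shows "continuous_on UNIV (pencil_inv B X)"
proof -
  obtain m :: "'n \<Rightarrow> real" and Q :: "'n \<Rightarrow> complex^'n^'n" where m: "\<And>i. 0 < m i"
    and R: "\<And>u. pencil_inv B X u = (\<Sum>i\<in>UNIV. (1 / (m i + exp u)) *\<^sub>R Q i)"
    and P: "\<And>s. C ** mat_powr (C ** X ** C) s ** C = (\<Sum>i\<in>UNIV. m i powr s *\<^sub>R Q i)"
    by (rule pencil_inv_decomposition[OF C CD assms, folded B_def]) (rule that)
  have "m i + exp u \<noteq> 0" for i u using m[of i] exp_gt_zero[of u] by linarith
  then show ?thesis unfolding R by (intro continuous_intros ballI)
qed

text \<open>The constant serves all matrices near \<open>X\<close> at once, as the remainder estimate below demands.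
  Half of the lower bound of \<open>X\<close> is left over for the perturbation.\<close>

lemma norm_pencil_inv_bound:
  assumes "pos_def X"
  obtains c where "0 < c" "\<And>H u. hermitian H \<Longrightarrow> norm H < 1 / c \<Longrightarrow> pos_def (X + H) \<and>
      norm (pencil_inv B (X + H) u) \<le> c / (1 + exp u)"
proof -
  have hX: "hermitian X" and hB: "hermitian B" using assms pos_def_B by (auto simp: pos_def_def)
  obtain x where x: "0 < x" "loewner_le (x *\<^sub>R mat 1) X"
    using pos_def_imp_scalar_loewner_le[OF assms] .
  obtain b where b: "0 < b" "loewner_le (b *\<^sub>R mat 1) B"
    using pos_def_imp_scalar_loewner_le[OF pos_def_B] .
  have weaken: "loewner_le (r *\<^sub>R mat 1) Z"
    if "hermitian Z" "loewner_le (s *\<^sub>R mat 1) Z" "r \<le> s" for r s and Z :: "complex^'n^'n"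
    using that unfolding scalar_loewner_le_iff[OF that(1)]
    by (meson inner_ge_zero mult_right_mono order_trans)
  define l where "l = min (x / 2) b"
  have l: "0 < l" "l \<le> x / 2" "l \<le> b" using x b by (auto simp: l_def)
  define c where "c = real CARD('n) / l"
  have c: "0 < c" using l by (simp add: c_def)
  have small: "pos_def (X + H) \<and> norm (pencil_inv B (X + H) u) \<le> c / (1 + exp u)"
    if H: "hermitian H" "norm H < 1 / c" for H u
  proof -
    have hXH: "hermitian (X + H)" by (intro hermitian_add hX H)
    have "1 / c \<le> l"
      using l by (simp add: c_def divide_le_eq mult_le_cancel_left1 Suc_le_eq)
    then have "l \<le> x - norm H" using l H by linarith
    then have XH: "loewner_le (l *\<^sub>R mat 1) (X + H)"
      using weaken[OF hXH scalar_loewner_le_perturb[OF hX H(1) x(2)]] by simp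
    show ?thesis
      unfolding c_def
      by (intro conjI scalar_loewner_le_imp_pos_def[OF hXH l(1) XH]
          norm_pencil_inv_le[OF hXH hB l(1) XH] weaken[OF hB b(2) l(3)])
  qed
  show thesis by (rule that[OF c small])
qed

lemma integrable_pencil_integrals:
  assumes "pos_def X"
  shows "integrable lborel (\<lambda>u. exp (t * u) *\<^sub>R pencil_inv B X u)"
    and "integrable lborel (\<lambda>u. exp (t * u) *\<^sub>R (pencil_inv B X u ** Y ** pencil_inv B X u))"
proof -
  note cont = continuous_pencil_inv[OF assms]
  obtain c where c: "0 < c" and bound: "\<And>H u. hermitian H \<Longrightarrow> norm H < 1 / c \<Longrightarrow>
      pos_def (X + H) \<and> norm (pencil_inv B (X + H) u) \<le> c / (1 + exp u)"
    by (rule norm_pencil_inv_bound[OF assms]) (rule that)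
  have "hermitian (0 :: complex^'n^'n)" by (simp add: hermitian_def vec_eq_iff)
  then have R: "norm (pencil_inv B X u) \<le> c / (1 + exp u)" for u
    using bound[of 0] c by simp
  obtain K where K: "0 < K"
    and mult: "\<And>(E :: complex^'n^'n) (F :: complex^'n^'n). norm (E ** F) \<le> norm E * norm F * K"
    using matmul.pos_bounded by blast
  have pos: "0 < 1 + exp u" for u :: real by (simp add: add_pos_pos)
  show "integrable lborel (\<lambda>u. exp (t * u) *\<^sub>R pencil_inv B X u)"
  proof (rule Bochner_Integration.integrable_bound)
    show "integrable lborel (\<lambda>u. c * (exp (t * u) / (1 + exp u)))"
      by (intro integrable_mult_right integrable_exp_kernel t)
    have "continuous_on UNIV (\<lambda>u. exp (t * u) *\<^sub>R pencil_inv B X u)"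
      by (intro continuous_intros cont)
    then show "(\<lambda>u. exp (t * u) *\<^sub>R pencil_inv B X u) \<in> borel_measurable lborel"
      by (simp add: borel_measurable_continuous_onI)
    show "AE u in lborel. norm (exp (t * u) *\<^sub>R pencil_inv B X u) \<le> norm (c * (exp (t * u) / (1 + exp u)))"
    proof (rule AE_I2)
      fix u
      have "exp (t * u) * norm (pencil_inv B X u) \<le> exp (t * u) * (c / (1 + exp u))"
        by (intro mult_left_mono R) simp
      then show "norm (exp (t * u) *\<^sub>R pencil_inv B X u) \<le> norm (c * (exp (t * u) / (1 + exp u)))"
        using c pos[of u] by (simp add: abs_mult mult.commute)
    qed
  qed
  show "integrable lborel (\<lambda>u. exp (t * u) *\<^sub>R (pencil_inv B X u ** Y ** pencil_inv B X u))"
  proof (rule Bochner_Integration.integrable_bound)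
    show "integrable lborel (\<lambda>u. (c * norm Y * K * c * K) * (exp (t * u) / (1 + exp u)\<^sup>2))"
      by (intro integrable_mult_right integrable_exp_kernel_square t)
    have "continuous_on UNIV (\<lambda>u. exp (t * u) *\<^sub>R (pencil_inv B X u ** Y ** pencil_inv B X u))"
      by (intro continuous_intros matmul.continuous_on cont)
    then show "(\<lambda>u. exp (t * u) *\<^sub>R (pencil_inv B X u ** Y ** pencil_inv B X u)) \<in> borel_measurable lborel"
      by (simp add: borel_measurable_continuous_onI)
    have bd: "norm (pencil_inv B X u ** Y ** pencil_inv B X u)
        \<le> c / (1 + exp u) * norm Y * K * (c / (1 + exp u)) * K" for u
      using K R c pos[of u]
      by (intro order_trans[OF mult] mult_mono mult_right_mono) (simp_all add: less_imp_le)
    show "AE u in lborel. norm (exp (t * u) *\<^sub>R (pencil_inv B X u ** Y ** pencil_inv B X u))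
        \<le> norm ((c * norm Y * K * c * K) * (exp (t * u) / (1 + exp u)\<^sup>2))"
    proof (rule AE_I2)
      fix u
      have "exp (t * u) * norm (pencil_inv B X u ** Y ** pencil_inv B X u)
          \<le> exp (t * u) * (c / (1 + exp u) * norm Y * K * (c / (1 + exp u)) * K)"
        by (intro mult_left_mono bd) simp
      also have "\<dots> = (c * norm Y * K * c * K) * (exp (t * u) / (1 + exp u)\<^sup>2)"
        by (simp add: power2_eq_square)
      finally show "norm (exp (t * u) *\<^sub>R (pencil_inv B X u ** Y ** pencil_inv B X u))
          \<le> norm ((c * norm Y * K * c * K) * (exp (t * u) / (1 + exp u)\<^sup>2))"
        using c K by (simp add: abs_mult)
    qed
  qed
qed

text \<open>In the decomposition of the inverses along an eigenbasis of \<open>C X C\<close>, the integral acts on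
  each coefficient as in the scalar formula for \<open>m\<^bsup>t-1\<^esup>\<close>.\<close>

lemma pencil_integral_eq:
  assumes "pos_def X"
  shows "pencil_integral t B X = power_const t *\<^sub>R (C ** mat_powr (C ** X ** C) (t - 1) ** C)"
proof -
  obtain m :: "'n \<Rightarrow> real" and Q :: "'n \<Rightarrow> complex^'n^'n" where m: "\<And>i. 0 < m i"
    and R: "\<And>u. pencil_inv B X u = (\<Sum>i\<in>UNIV. (1 / (m i + exp u)) *\<^sub>R Q i)"
    and P: "\<And>s. C ** mat_powr (C ** X ** C) s ** C = (\<Sum>i\<in>UNIV. m i powr s *\<^sub>R Q i)"
    by (rule pencil_inv_decomposition[OF C CD assms, folded B_def]) (rule that)
  have "has_bochner_integral lborel (\<lambda>u. \<Sum>i\<in>UNIV. (exp (t * u) / (m i + exp u)) *\<^sub>R Q i)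
      (\<Sum>i\<in>UNIV. (m i powr (t - 1) * power_const t) *\<^sub>R Q i)"
    by (intro has_bochner_integral_sum has_bochner_integral_scaleR_left has_bochner_integral_power t m)
  then have "pencil_integral t B X = (\<Sum>i\<in>UNIV. (m i powr (t - 1) * power_const t) *\<^sub>R Q i)"
    unfolding pencil_integral_def R by (simp add: scaleR_sum_right has_bochner_integral_iff)
  then show ?thesis by (simp add: P scaleR_sum_right mult.commute)
qed

lemma linear_pencil_integral_deriv:
  assumes "pos_def X"
  shows "linear (pencil_integral_deriv t B X)"
proof (rule linearI)
  note int = integrable_pencil_integrals(2)[OF assms]
  show "pencil_integral_deriv t B X (Y + Z) = pencil_integral_deriv t B X Y + pencil_integral_deriv t B X Z"
    for Y Z
    using Bochner_Integration.integral_add[OF int int, of Y Z]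
    by (simp add: pencil_integral_deriv_def matmul.add_left matmul.add_right scaleR_add_right)
  show "pencil_integral_deriv t B X (a *\<^sub>R Y) = a *\<^sub>R pencil_integral_deriv t B X Y" for a Y
    using integral_scaleR_right[where c = a and M = lborel
        and f = "\<lambda>u. exp (t * u) *\<^sub>R (pencil_inv B X u ** Y ** pencil_inv B X u)"]
    by (simp add: pencil_integral_deriv_def matmul.scaleR_left matmul.scaleR_right mult.commute)
qed

lemma hermitian_pencil_integral_deriv:
  assumes "pos_def X" "hermitian Y"
  shows "hermitian (pencil_integral_deriv t B X Y)"
proof -
  have R: "hermitian (pencil_inv B X u)" for u
    by (rule pos_def_matrix_inv(3)[OF pos_def_pencil[OF assms(1)]])
  have "adjoint_mat (exp (t * u) *\<^sub>R (pencil_inv B X u ** Y ** pencil_inv B X u)) =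
      exp (t * u) *\<^sub>R (pencil_inv B X u ** Y ** pencil_inv B X u)" for u
    using R[of u] assms(2)
    by (simp add: hermitian_def adjoint_mat_scaleR adjoint_mat_mult matrix_mul_assoc)
  then show ?thesis
    using integral_bounded_linear[OF bounded_linear_adjoint integrable_pencil_integrals(2)[OF assms(1)], of Y]
    by (simp add: hermitian_def pencil_integral_deriv_def adjoint_mat_minus)
qed

text \<open>The second-order remainder \<open>R' H R H R\<close> of the resolvent decays in \<open>u\<close> at least as fast as
  one resolvent, uniformly for \<open>X + H\<close> near \<open>X\<close>, which makes the remainder of the integral
  quadratic in \<open>H\<close>.\<close>

lemma pencil_integral_remainder:
  assumes "pos_def X"
  obtains d c where "0 < d"
    "\<And>H. hermitian H \<Longrightarrow> norm H < d \<Longrightarrow> pos_def (X + H) \<and>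
      norm (pencil_integral t B (X + H) - pencil_integral t B X - pencil_integral_deriv t B X H)
        \<le> c * (norm H)\<^sup>2"
proof -
  obtain c where c: "0 < c" and bound: "\<And>H u. hermitian H \<Longrightarrow> norm H < 1 / c \<Longrightarrow>
      pos_def (X + H) \<and> norm (pencil_inv B (X + H) u) \<le> c / (1 + exp u)"
    by (rule norm_pencil_inv_bound[OF assms]) (rule that)
  have "hermitian (0 :: complex^'n^'n)" by (simp add: hermitian_def vec_eq_iff)
  then have R_le: "norm (pencil_inv B X u) \<le> c / (1 + exp u)" for u
    using bound[of 0] c by simp
  obtain K where K: "0 < K"
    and mult: "\<And>(E :: complex^'n^'n) (F :: complex^'n^'n). norm (E ** F) \<le> norm E * norm F * K"
    using matmul.pos_bounded by blast
  have "pos_def (X + H) \<and>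
      norm (pencil_integral t B (X + H) - pencil_integral t B X - pencil_integral_deriv t B X H)
        \<le> (c ^ 3 * K ^ 4 * power_const t) * (norm H)\<^sup>2"
    if H: "hermitian H" "norm H < 1 / c" for H
  proof
    show XH: "pos_def (X + H)" using bound[OF H] by blast
    define R where "R = pencil_inv B X"
    define R' where "R' = pencil_inv B (X + H)"
    define h where "h = (\<lambda>u. exp (t * u) *\<^sub>R (R' u - R u + R u ** H ** R u))"
    have int: "integrable lborel (\<lambda>u. exp (t * u) *\<^sub>R R' u)"
        "integrable lborel (\<lambda>u. exp (t * u) *\<^sub>R R u)"
        "integrable lborel (\<lambda>u. exp (t * u) *\<^sub>R (R u ** H ** R u))"
      unfolding R_def R'_def by (intro integrable_pencil_integrals XH assms)+
    have h_eq: "h = (\<lambda>u. exp (t * u) *\<^sub>R R' u - exp (t * u) *\<^sub>R R u + exp (t * u) *\<^sub>R (R u ** H ** R u))"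
      by (simp add: h_def scaleR_add_right scaleR_diff_right)
    have int_h: "integrable lborel h"
      unfolding h_eq by (intro Bochner_Integration.integrable_add Bochner_Integration.integrable_diff int)
    have "pencil_integral t B (X + H) - pencil_integral t B X - pencil_integral_deriv t B X H =
        (LBINT u. h u)"
      unfolding h_eq
      using int by (simp add: pencil_integral_def pencil_integral_deriv_def R_def R'_def)
    also have "norm \<dots> \<le> (LBINT u. norm (h u))" by (rule integral_norm_bound)
    also have "\<dots> \<le> (LBINT u. (c ^ 3 * K ^ 4 * (norm H)\<^sup>2) * (exp (t * u) / (1 + exp u)))"
    proof (rule integral_mono)
      show "integrable lborel (\<lambda>u. norm (h u))" using int_h by simp
      show "integrable lborel (\<lambda>u. (c ^ 3 * K ^ 4 * (norm H)\<^sup>2) * (exp (t * u) / (1 + exp u)))"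
        by (intro integrable_mult_right integrable_exp_kernel t)
      fix u
      define q where "q = c / (1 + exp u)"
      have pos: "1 \<le> 1 + exp u" "0 < 1 + exp u" by (simp_all add: add_pos_pos)
      have q: "0 \<le> q" "q \<le> c" using c pos by (simp_all add: q_def divide_le_eq mult_le_cancel_left1)
      have "R' u - R u + R u ** H ** R u = R' u ** H ** R u ** H ** R u"
        using matrix_inv_expansion[OF pos_def_pencil[OF assms], of u H] pos_def_pencil[OF XH, of u]
        by (simp add: R_def R'_def add_ac)
      also have "norm \<dots> \<le> q * norm H * K * q * K * norm H * K * q * K"
        using K q R_le[of u] bound[OF H, of u]
        by (intro order_trans[OF mult] mult_mono mult_right_mono)
          (simp_all add: R_def R'_def q_def less_imp_le)
      (* One factor q is enough for integrability; the other two are bounded by c. *)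
      also have "\<dots> = (q * q) * (K ^ 4 * (norm H)\<^sup>2 * q)"
        by (simp add: power2_eq_square power4_eq_xxxx)
      also have "\<dots> \<le> (c * c) * (K ^ 4 * (norm H)\<^sup>2 * q)"
        using q c K by (intro mult_right_mono mult_mono) simp_all
      finally have "norm (h u) \<le> exp (t * u) * ((c * c) * (K ^ 4 * (norm H)\<^sup>2 * q))"
        unfolding h_def norm_scaleR by (simp add: mult_left_mono)
      also have "\<dots> = (c ^ 3 * K ^ 4 * (norm H)\<^sup>2) * (exp (t * u) / (1 + exp u))"
        by (simp add: q_def power3_eq_cube)
      finally show "norm (h u) \<le> (c ^ 3 * K ^ 4 * (norm H)\<^sup>2) * (exp (t * u) / (1 + exp u))" .
    qed
    also have "\<dots> = (c ^ 3 * K ^ 4 * (norm H)\<^sup>2) * power_const t"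
      unfolding power_const_def by (rule integral_mult_right_zero)
    finally show "norm (pencil_integral t B (X + H) - pencil_integral t B X -
        pencil_integral_deriv t B X H) \<le> (c ^ 3 * K ^ 4 * power_const t) * (norm H)\<^sup>2"
      by (simp add: mult_ac)
  qed
  moreover have "0 < 1 / c" using c by simp
  ultimately show thesis by (rule that[rotated])
qed

text \<open>Under the integral, scalar bounds replace \<open>X + exp u B\<close> by the scalars
  \<open>x + b exp u\<close>, and the integral of the resulting kernel is known.\<close>

lemma pencil_integral_deriv_bounds:
  assumes X: "hermitian X" "0 < x\<^sub>1" "loewner_le (x\<^sub>1 *\<^sub>R mat 1) X" "loewner_le X (x\<^sub>2 *\<^sub>R mat 1)"
    and B: "0 < b\<^sub>1" "loewner_le (b\<^sub>1 *\<^sub>R mat 1) B" "loewner_le B (b\<^sub>2 *\<^sub>R mat 1)"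
    and le: "x\<^sub>1 \<le> x\<^sub>2" "b\<^sub>1 \<le> b\<^sub>2"
  shows "x\<^sub>2 powr (t - 2) * b\<^sub>2 powr (- t) * ((1 - t) * power_const t) * (Y \<bullet> Y)
      \<le> - (pencil_integral_deriv t B X Y \<bullet> Y)"
    and "- (pencil_integral_deriv t B X Y \<bullet> Y)
      \<le> x\<^sub>1 powr (t - 2) * b\<^sub>1 powr (- t) * ((1 - t) * power_const t) * (Y \<bullet> Y)"
proof -
  have hB: "hermitian B" using pos_def_B by (simp add: pos_def_def)
  have pX: "pos_def X" using X scalar_loewner_le_imp_pos_def by blast
  define g where "g = (\<lambda>u. exp (t * u) * ((pencil_inv B X u ** Y ** pencil_inv B X u) \<bullet> Y))"
  note int = integrable_pencil_integrals(2)[OF pX, of Y]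
  have g_eq: "g = (\<lambda>u. (exp (t * u) *\<^sub>R (pencil_inv B X u ** Y ** pencil_inv B X u)) \<bullet> Y)"
    by (simp add: g_def)
  have int_g: "integrable lborel g"
    unfolding g_eq by (rule integrable_inner_left) (rule int)
  have D: "- (pencil_integral_deriv t B X Y \<bullet> Y) = (LBINT u. g u)"
    unfolding g_eq pencil_integral_deriv_def integral_inner_left[OF int] by simp
  have kernel: "integrable lborel (\<lambda>u. exp (t * u) / (x + b * exp u)\<^sup>2 * (Y \<bullet> Y))"
      "(LBINT u. exp (t * u) / (x + b * exp u)\<^sup>2 * (Y \<bullet> Y)) =
        x powr (t - 2) * b powr (- t) * ((1 - t) * power_const t) * (Y \<bullet> Y)"
    if "0 < x" "0 < b" for x b
    using has_bochner_integral_mult_left[OF has_bochner_integral_power_square[OF t that], of "Y \<bullet> Y"]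
    unfolding has_bochner_integral_iff by blast+
  have sandwich: "Y \<bullet> Y / (x\<^sub>2 + b\<^sub>2 * exp u)\<^sup>2 \<le> (pencil_inv B X u ** Y ** pencil_inv B X u) \<bullet> Y"
      "(pencil_inv B X u ** Y ** pencil_inv B X u) \<bullet> Y \<le> Y \<bullet> Y / (x\<^sub>1 + b\<^sub>1 * exp u)\<^sup>2" for u
  proof -
    have "0 < x\<^sub>1 + b\<^sub>1 * exp u" using X B by (simp add: add_pos_pos)
    note inner_sandwich_matrix_inv[OF hermitian_add[OF X(1) hermitian_scaleR[OF hB]] this
        loewner_le_pencil(1)[OF X(1) hB exp_ge_zero X(3) B(2)]
        loewner_le_pencil(2)[OF X(1) hB exp_ge_zero X(4) B(3)], of Y]
    then show "Y \<bullet> Y / (x\<^sub>2 + b\<^sub>2 * exp u)\<^sup>2 \<le> (pencil_inv B X u ** Y ** pencil_inv B X u) \<bullet> Y"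
      "(pencil_inv B X u ** Y ** pencil_inv B X u) \<bullet> Y \<le> Y \<bullet> Y / (x\<^sub>1 + b\<^sub>1 * exp u)\<^sup>2" .
  qed
  show "x\<^sub>2 powr (t - 2) * b\<^sub>2 powr (- t) * ((1 - t) * power_const t) * (Y \<bullet> Y)
      \<le> - (pencil_integral_deriv t B X Y \<bullet> Y)"
  proof -
    have p: "0 < x\<^sub>2" "0 < b\<^sub>2" using X B le by linarith+
    have "exp (t * u) / (x\<^sub>2 + b\<^sub>2 * exp u)\<^sup>2 * (Y \<bullet> Y) \<le> g u" for u
      using mult_left_mono[OF sandwich(1)[of u], of "exp (t * u)"] by (simp add: g_def)
    then show ?thesis
      unfolding D kernel(2)[OF p, symmetric] by (intro integral_mono kernel(1)[OF p] int_g)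
  qed
  show "- (pencil_integral_deriv t B X Y \<bullet> Y)
      \<le> x\<^sub>1 powr (t - 2) * b\<^sub>1 powr (- t) * ((1 - t) * power_const t) * (Y \<bullet> Y)"
  proof -
    have p: "0 < x\<^sub>1" "0 < b\<^sub>1" using X B by linarith+
    have "g u \<le> exp (t * u) / (x\<^sub>1 + b\<^sub>1 * exp u)\<^sup>2 * (Y \<bullet> Y)" for u
      using mult_left_mono[OF sandwich(2)[of u], of "exp (t * u)"] by (simp add: g_def)
    then show ?thesis
      unfolding D kernel(2)[OF p, symmetric] by (intro integral_mono kernel(1)[OF p] int_g)
  qed
qed

end

section \<open>Gradients and Hessians\<close>

text \<open>A vector field that supports a concave function from above is its gradient wherever the field
  is continuous: swapping the two points gives a lower bound of the same form.\<close>

lemma has_derivative_supergradient: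
  fixes f :: "'a::real_inner \<Rightarrow> real"
  assumes "open S" "x \<in> S" and super: "\<And>y z. y \<in> S \<Longrightarrow> z \<in> S \<Longrightarrow> f z - f y \<le> G y \<bullet> (z - y)"
    and G: "isCont G x"
  shows "(f has_derivative (\<lambda>h. G x \<bullet> h)) (at x)"
proof -
  obtain e where e: "0 < e" "ball x e \<subseteq> S" using assms by (meson open_contains_ball)
  show ?thesis
  proof (rule has_derivativeI_sandwich[OF e(1)])
    show "bounded_linear (\<lambda>h. G x \<bullet> h)" by (rule bounded_linear_inner_right)
    show "((\<lambda>y. norm (G y - G x)) \<longlongrightarrow> 0) (at x)"
      using G by (intro tendsto_norm_zero) (simp add: LIM_zero_iff isCont_def)
    fix y assume "y \<noteq> x" and "dist y x < e"
    then have y: "y \<in> S" using e by (auto simp: dist_commute)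
    have "f y - f x - G x \<bullet> (y - x) \<le> 0" using super[OF assms(2) y] by simp
    moreover have "(G y - G x) \<bullet> (y - x) \<le> f y - f x - G x \<bullet> (y - x)"
      using super[OF y assms(2)] by (simp add: inner_diff_left inner_diff_right)
    ultimately have "norm (f y - f x - G x \<bullet> (y - x)) \<le> \<bar>(G y - G x) \<bullet> (y - x)\<bar>"
      unfolding real_norm_def by linarith
    also have "\<dots> \<le> norm (G y - G x) * norm (y - x)" by (rule Cauchy_Schwarz_ineq2)
    finally show "norm (f y - f x - G x \<bullet> (y - x)) / norm (y - x) \<le> norm (G y - G x)"
      using \<open>y \<noteq> x\<close> by (simp add: divide_le_eq)
  qed
qed

lemma has_derivative_quadratic_remainder:
  fixes G :: "'a::real_normed_vector \<Rightarrow> 'b::real_normed_vector"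
  assumes "bounded_linear D" "0 < d"
    and rem: "\<And>h. norm h < d \<Longrightarrow> norm (G (x + h) - G x - D h) \<le> c * (norm h)\<^sup>2"
  shows "(G has_derivative D) (at x)"
proof (rule has_derivativeI_sandwich[OF \<open>0 < d\<close> \<open>bounded_linear D\<close>])
  have "((\<lambda>y. c * norm (y - x)) \<longlongrightarrow> c * norm (x - x)) (at x)" by (intro tendsto_intros)
  then show "((\<lambda>y. c * norm (y - x)) \<longlongrightarrow> 0) (at x)" by simp
  fix y assume "y \<noteq> x" and "dist y x < d"
  then show "norm (G y - G x - D (y - x)) / norm (y - x) \<le> c * norm (y - x)"
    using rem[of "y - x"] by (simp add: dist_norm divide_le_eq power2_eq_square mult.assoc)
qed

text \<open>The identity \<open>f' = \<langle>G, \<sqdot>\<rangle>\<close> is needed on a whole neighbourhood, since the second derivative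
  differentiates the map that sends a point to its derivative.\<close>

lemma hessian_eqI:
  fixes f :: "'a::real_inner \<Rightarrow> real"
  assumes S: "open S" "x \<in> S" and grad: "\<And>y. y \<in> S \<Longrightarrow> (f has_derivative (\<lambda>h. G y \<bullet> h)) (at y)"
    and D: "(G has_derivative D) (at x)"
  shows "hessian f x = D"
proof -
  have first: "first_deriv f y = blinfun_inner_left (G y)" if "y \<in> S" for y
    unfolding first_deriv_def frechet_derivative_at[OF grad[OF that], symmetric]
    by (rule blinfun_eqI) (simp add: bounded_linear_Blinfun_apply bounded_linear_inner_right inner_commute)
  have "((\<lambda>y. blinfun_inner_left (G y)) has_derivative (\<lambda>Y. blinfun_inner_left (D Y))) (at x)"
    by (rule bounded_linear.has_derivative[OF bounded_linear_blinfun_inner_left D])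
  then have "(first_deriv f has_derivative (\<lambda>Y. blinfun_inner_left (D Y))) (at x)"
    by (rule has_derivative_transform_within_open[OF _ S]) (simp add: first)
  then have "second_deriv f x Y Z = D Y \<bullet> Z" for Y Z
    unfolding second_deriv_def by (simp add: frechet_derivative_at[symmetric] inner_commute)
  then show ?thesis
    unfolding hessian_def by (intro the_equality) (auto simp: fun_eq_iff vector_eq_rdot)
qed

section \<open>Hermitian matrices as a space\<close>

lemma hermitian_mat_of [simp]: "hermitian (mat_of X)"
  using mat_of[of X] by simp

lemma inner_herm_eq: "X \<bullet> Y = mat_of X \<bullet> mat_of Y"
  by (simp add: inner_herm_def trace_mult_hermitian)

lemma norm_herm_eq: "norm X = norm (mat_of X)"
  by (simp add: norm_eq_sqrt_inner inner_herm_eq)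

lemma mat_of_Herm: "hermitian A \<Longrightarrow> mat_of (Herm A) = A"
  by (simp add: Herm_inverse)

lemmas mat_of_simps = plus_herm.rep_eq minus_herm.rep_eq scaleR_herm.rep_eq

lemma open_posdef_herm: "open (posdef_herm :: ('n::finite) herm set)"
  unfolding open_contains_ball
proof
  fix X :: "'n herm" assume "X \<in> posdef_herm"
  then obtain c where c: "0 < c" "loewner_le (c *\<^sub>R mat 1) (mat_of X)"
    using pos_def_imp_scalar_loewner_le unfolding posdef_herm_def by blast
  have "Y \<in> posdef_herm" if "Y \<in> ball X c" for Y
  proof -
    have *: "loewner_le ((c - norm (mat_of (Y - X))) *\<^sub>R mat 1) (mat_of X + mat_of (Y - X))"
      by (intro scalar_loewner_le_perturb c) simp_all
    have "norm (mat_of (Y - X)) < c"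
      using that by (simp add: dist_norm norm_herm_eq[symmetric] norm_minus_commute)
    moreover have "mat_of X + mat_of (Y - X) = mat_of Y" by (simp add: mat_of_simps)
    ultimately show ?thesis
      unfolding posdef_herm_def
      using * scalar_loewner_le_imp_pos_def[of "mat_of Y" "c - norm (mat_of (Y - X))"] by simp
  qed
  then show "\<exists>e>0. ball X e \<subseteq> posdef_herm" using c(1) by blast
qed

context pencil
begin

text \<open>For the weight of the pencil, this is \<open>X \<mapsto> t C (C X C)\<^bsup>t-1\<^esup> C\<close>; the integral form is the one
  that can be differentiated.\<close>

definition gradient :: "'n herm \<Rightarrow> 'n herm" where
  "gradient X = Herm ((t / power_const t) *\<^sub>R pencil_integral t B (mat_of X))"

definition gradient_deriv :: "'n herm \<Rightarrow> 'n herm \<Rightarrow> 'n herm" where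
  "gradient_deriv X Y = Herm ((t / power_const t) *\<^sub>R pencil_integral_deriv t B (mat_of X) (mat_of Y))"

lemma mat_of_gradient:
  assumes "X \<in> posdef_herm"
  shows "mat_of (gradient X) = (t / power_const t) *\<^sub>R pencil_integral t B (mat_of X)"
    and "mat_of (gradient X) = t *\<^sub>R (C ** mat_powr (C ** mat_of X ** C) (t - 1) ** C)"
proof -
  have pX: "pos_def (mat_of X)" using assms by (simp add: posdef_herm_def)
  have eq: "(t / power_const t) *\<^sub>R pencil_integral t B (mat_of X) =
      t *\<^sub>R (C ** mat_powr (C ** mat_of X ** C) (t - 1) ** C)"
    using power_const_pos[OF t] by (simp add: pencil_integral_eq[OF pX])
  have h: "hermitian (t *\<^sub>R (C ** mat_powr (C ** mat_of X ** C) (t - 1) ** C))"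
    by (intro hermitian_scaleR hermitian_congruence hermitian_mat_powr C hermitian_mat_of)
  show "mat_of (gradient X) = (t / power_const t) *\<^sub>R pencil_integral t B (mat_of X)"
    "mat_of (gradient X) = t *\<^sub>R (C ** mat_powr (C ** mat_of X ** C) (t - 1) ** C)"
    unfolding gradient_def eq by (simp_all add: mat_of_Herm[OF h])
qed

lemma mat_of_gradient_deriv:
  assumes "X \<in> posdef_herm"
  shows "mat_of (gradient_deriv X Y) =
    (t / power_const t) *\<^sub>R pencil_integral_deriv t B (mat_of X) (mat_of Y)"
  unfolding gradient_deriv_def using assms
  by (intro mat_of_Herm hermitian_scaleR hermitian_pencil_integral_deriv hermitian_mat_of)
    (simp add: posdef_herm_def)

text \<open>The quadratic remainder estimate for Hermitian matrices carries over along the isometry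
  \<open>mat_of\<close>.\<close>

lemma has_derivative_gradient:
  assumes "X \<in> posdef_herm"
  shows "(gradient has_derivative gradient_deriv X) (at X)"
proof -
  have pX: "pos_def (mat_of X)" using assms by (simp add: posdef_herm_def)
  note mat_of_deriv = mat_of_gradient_deriv[OF assms]
  have lin: "bounded_linear (pencil_integral_deriv t B (mat_of X))"
    using linear_pencil_integral_deriv[OF pX] by (simp add: linear_conv_bounded_linear)
  obtain K where K: "\<And>Y. norm (pencil_integral_deriv t B (mat_of X) Y) \<le> norm Y * K"
    using bounded_linear.bounded[OF lin] by blast
  have p: "0 < t / power_const t" using power_const_pos[OF t] t by simp
  have bl: "bounded_linear (gradient_deriv X)"
  proof (rule bounded_linear_intro)
    show "gradient_deriv X (Y + Z) = gradient_deriv X Y + gradient_deriv X Z" for Y Z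
      unfolding mat_of_inject[symmetric]
      by (simp add: mat_of_deriv mat_of_simps linear_add[OF bounded_linear.linear[OF lin]]
          scaleR_add_right)
    show "gradient_deriv X (r *\<^sub>R Y) = r *\<^sub>R gradient_deriv X Y" for r Y
      unfolding mat_of_inject[symmetric]
      by (simp add: mat_of_deriv mat_of_simps linear_scale[OF bounded_linear.linear[OF lin]])
    show "norm (gradient_deriv X Y) \<le> norm Y * (t / power_const t * K)" for Y
      using mult_left_mono[OF K[of "mat_of Y"] less_imp_le[OF p]] t power_const_pos[OF t]
      by (simp add: norm_herm_eq mat_of_deriv mult_ac)
  qed
  obtain d c where d: "0 < d" and rem: "\<And>H. hermitian H \<Longrightarrow> norm H < d \<Longrightarrow> pos_def (mat_of X + H) \<and>
      norm (pencil_integral t B (mat_of X + H) - pencil_integral t B (mat_of X)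
        - pencil_integral_deriv t B (mat_of X) H) \<le> c * (norm H)\<^sup>2"
    by (rule pencil_integral_remainder[OF pX]) (rule that)
  show ?thesis
  proof (rule has_derivative_quadratic_remainder[OF bl d])
    fix H :: "'n herm" assume H: "norm H < d"
    have r: "pos_def (mat_of X + mat_of H)" "norm (pencil_integral t B (mat_of X + mat_of H) -
        pencil_integral t B (mat_of X) - pencil_integral_deriv t B (mat_of X) (mat_of H))
        \<le> c * (norm H)\<^sup>2"
      using rem[of "mat_of H"] H by (simp_all add: norm_herm_eq)
    then have XH: "X + H \<in> posdef_herm" by (simp add: posdef_herm_def mat_of_simps)
    have "mat_of (gradient (X + H) - gradient X - gradient_deriv X H) =
        (t / power_const t) *\<^sub>R (pencil_integral t B (mat_of X + mat_of H) -
        pencil_integral t B (mat_of X) - pencil_integral_deriv t B (mat_of X) (mat_of H))"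
      by (simp add: mat_of_simps mat_of_gradient(1)[OF assms] mat_of_gradient(1)[OF XH] mat_of_deriv
          scaleR_diff_right)
    then show "norm (gradient (X + H) - gradient X - gradient_deriv X H)
        \<le> (t / power_const t * c) * (norm H)\<^sup>2"
      using mult_left_mono[OF r(2) less_imp_le[OF p]] t power_const_pos[OF t] by (simp add: norm_herm_eq mult.assoc)
  qed
qed

text \<open>Klein's inequality at \<open>C X C\<close> and \<open>C Y C\<close>; moving the two outer factors \<open>C\<close> to the other side of
  the inner product turns its linear term into the gradient.\<close>

lemma trace_powr_supergradient:
  assumes "X \<in> posdef_herm" "Y \<in> posdef_herm"
  shows "mat_powr (C ** mat_of Y ** C) t \<bullet> mat 1 - mat_powr (C ** mat_of X ** C) t \<bullet> mat 1
    \<le> gradient X \<bullet> (Y - X)"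
proof -
  let ?P = "mat_powr (C ** mat_of X ** C) (t - 1)"
  have "C ** mat_of Y ** C - C ** mat_of X ** C = C ** mat_of (Y - X) ** C"
    by (simp add: mat_of_simps matmul.diff_left matmul.diff_right)
  moreover have "mat_powr (C ** mat_of Y ** C) t \<bullet> mat 1 \<le> mat_powr (C ** mat_of X ** C) t \<bullet> mat 1
      + t * (?P \<bullet> (C ** mat_of Y ** C - C ** mat_of X ** C))"
    using assms
    by (intro trace_powr_le_tangent pos_def_congruence[OF C CD(2)] t) (simp_all add: posdef_herm_def)
  moreover have "?P \<bullet> (C ** Z ** C) = (C ** ?P ** C) \<bullet> Z" for Z
    using C by (simp add: inner_matrix_mult_right[of "C ** ?P"] inner_matrix_mult_left[of C ?P]
        hermitian_def matrix_mul_assoc)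
  ultimately show ?thesis
    by (simp add: inner_herm_eq mat_of_gradient(2)[OF assms(1)])
qed

lemma hessian_trace_powr:
  fixes f :: "'n herm \<Rightarrow> real"
  assumes f: "\<And>X. X \<in> posdef_herm \<Longrightarrow> f X = mat_powr (C ** mat_of X ** C) t \<bullet> mat 1"
    and X: "X \<in> posdef_herm"
  shows "hessian f X = gradient_deriv X"
proof (rule hessian_eqI[OF open_posdef_herm X])
  show "(gradient has_derivative gradient_deriv X) (at X)" by (rule has_derivative_gradient[OF X])
  show "(f has_derivative (\<lambda>h. gradient Y \<bullet> h)) (at Y)" if "Y \<in> posdef_herm" for Y
    by (rule has_derivative_supergradient[OF open_posdef_herm that])
      (simp_all add: f trace_powr_supergradient has_derivative_continuous[OF has_derivative_gradient[OF that]])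
qed

end

section \<open>The bounds on the Hessian\<close>

theorem theorem1:
  fixes A :: "('n::finite) herm" and K :: "'n herm set"
    and f :: "'n herm \<Rightarrow> real" and t \<alpha> \<beta> :: real
  assumes "A \<in> posdef_herm"
    and "0 < t" and "t < 1"
    and "\<forall>X\<in>posdef_herm. f X =
      Re (trace (mat_powr
        (mat_powr (mat_of A) ((1 - t) / (2 * t)) ** mat_of X **
         mat_powr (mat_of A) ((1 - t) / (2 * t))) t))"
    and "compact K" and "convex K" and "K \<subseteq> posdef_herm"
    and "0 < \<alpha>" and "0 < \<beta>"
    and "\<forall>Y\<in>K \<union> {A}. loewner_le (\<alpha> *\<^sub>R mat 1) (mat_of Y) \<and>
                       loewner_le (mat_of Y) (\<beta> *\<^sub>R mat 1)"
  shows "\<forall>X\<in>K.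
      scalar_le_op (t * (1 - t) * \<alpha> powr (1 - t) * \<beta> powr (t - 2)) (\<lambda>Y. - hessian f X Y) \<and>
      op_le_scalar (\<lambda>Y. - hessian f X Y) (t * (1 - t) * \<beta> powr (1 - t) * \<alpha> powr (t - 2))"
proof
  fix X assume XK: "X \<in> K"
  note t = \<open>0 < t\<close> \<open>t < 1\<close>
  (* C and D are the powers s and -s of A, so that B = D ** D has the eigenvalues of A to the
     power -2 s, and (-2 s) (-t) = 1 - t is the exponent that the bounds call for. *)
  define s where "s = (1 - t) / (2 * t)"
  obtain V a where V: "unitary V" and A: "mat_of A = spec_mat V a"
    using hermitian_imp_spec_mat[OF hermitian_mat_of[of A]] .
  have a: "\<alpha> \<le> a i" "a i \<le> \<beta>" for i
    using assms(10) by (simp_all add: A scalar_loewner_le_spec_mat_iff[OF V]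
        spec_mat_loewner_le_scalar_iff[OF V])
  have a0: "0 < a i" for i using a(1)[of i] \<open>0 < \<alpha>\<close> by linarith
  have \<alpha>\<beta>: "\<alpha> \<le> \<beta>" using a[of undefined] by linarith
  define C where "C = mat_powr (mat_of A) s"
  define D where "D = mat_powr (mat_of A) (- s)"
  define B where "B = D ** D"
  have C_spec: "C = spec_mat V (\<lambda>i. a i powr s)" and D_spec: "D = spec_mat V (\<lambda>i. a i powr (- s))"
    by (simp_all add: C_def D_def A mat_powr_spec_mat[OF V])
  interpret pencil t B C D
  proof
    show "C ** D = mat 1" "D ** C = mat 1"
      using a0 by (simp_all add: C_spec D_spec spec_mat_mult[OF V] powr_add[symmetric] spec_mat_const[OF V]
          less_imp_neq[THEN not_sym])
  qed (use t in \<open>simp_all add: B_def C_spec D_spec hermitian_spec_mat\<close>)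
  have B_spec: "B = spec_mat V (\<lambda>i. a i powr (- 2 * s))"
    by (simp add: B_def D_spec spec_mat_mult[OF V] powr_add[symmetric])
  have s: "0 < s" using t by (simp add: s_def)
  have B_bounds: "loewner_le ((\<beta> powr (- 2 * s)) *\<^sub>R mat 1) B" "loewner_le B ((\<alpha> powr (- 2 * s)) *\<^sub>R mat 1)"
    unfolding B_spec scalar_loewner_le_spec_mat_iff[OF V] spec_mat_loewner_le_scalar_iff[OF V]
    using a a0 s \<open>0 < \<alpha>\<close> by (auto intro!: powr_mono2')
  have exponent: "(x powr (- 2 * s)) powr (- t) = x powr (1 - t)" for x :: real
  proof -
    have "2 * s * t = 1 - t" using t by (simp add: s_def)
    then show ?thesis by (simp add: powr_powr)
  qed
  have X: "X \<in> posdef_herm" using assms XK by blast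
  have hess: "hessian f X = gradient_deriv X"
    using assms(4) by (intro hessian_trace_powr[OF _ X]) (simp add: C_def s_def inner_mat_1)
  have X_bounds: "loewner_le (\<alpha> *\<^sub>R mat 1) (mat_of X)" "loewner_le (mat_of X) (\<beta> *\<^sub>R mat 1)"
    using assms(10) XK by auto
  have p: "0 < t / power_const t" "power_const t \<noteq> 0" using power_const_pos[OF t] t by simp_all
  have quad: "- hessian f X Y \<bullet> Y =
      t / power_const t * - (pencil_integral_deriv t B (mat_of X) (mat_of Y) \<bullet> mat_of Y)" for Y
    by (simp add: hess inner_herm_eq[of "gradient_deriv X Y"] mat_of_gradient_deriv[OF X])
  (* The exponent -2 s is negative: the lower bound for B comes from the upper bound for A. *)
  have b: "0 < \<beta> powr (- 2 * s)" "\<beta> powr (- 2 * s) \<le> \<alpha> powr (- 2 * s)"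
    using \<open>0 < \<alpha>\<close> \<open>0 < \<beta>\<close> \<alpha>\<beta> s by (auto intro: powr_mono2')
  note bounds = pencil_integral_deriv_bounds[OF hermitian_mat_of \<open>0 < \<alpha>\<close> X_bounds b(1) B_bounds
      \<alpha>\<beta> b(2), unfolded exponent]
  have "t * (1 - t) * \<alpha> powr (1 - t) * \<beta> powr (t - 2) * (Y \<bullet> Y) \<le> - hessian f X Y \<bullet> Y" for Y
    unfolding quad
    using mult_left_mono[OF bounds(1)[of "mat_of Y"] less_imp_le[OF p(1)]] p(2)
    by (simp add: inner_herm_eq[of Y Y] mult_ac)
  moreover have "- hessian f X Y \<bullet> Y \<le> t * (1 - t) * \<beta> powr (1 - t) * \<alpha> powr (t - 2) * (Y \<bullet> Y)" for Y
    unfolding quad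
    using mult_left_mono[OF bounds(2)[of "mat_of Y"] less_imp_le[OF p(1)]] p(2)
    by (simp add: inner_herm_eq[of Y Y] mult_ac)
  ultimately show "scalar_le_op (t * (1 - t) * \<alpha> powr (1 - t) * \<beta> powr (t - 2)) (\<lambda>Y. - hessian f X Y) \<and>
      op_le_scalar (\<lambda>Y. - hessian f X Y) (t * (1 - t) * \<beta> powr (1 - t) * \<alpha> powr (t - 2))"
    by (simp add: scalar_le_op_def op_le_scalar_def)
qed

end
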